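(* Let $F$ be the determinant or the permanent of a generic $n\times n$ matrix $A$. Then $$\frac12\binom{2n}{n}\le cr(F)\le sr(F)\le r(F).$$
   Context: Let $\mathsf k$ be a field of characteristic zero or of characteristic $p>2$. A generic $n\times n$ matrix $A=(a_{ij})$ is one whose entries are $n^2$ distinct variables; $\mathrm{Per}(A)=\sum_{\sigma}\prod_i a_{i,\sigma(i)}$ (sum over all permutations $\sigma$ of $\{1,\dots,n\}$) is the permanent. Put $R=\mathsf k[a_{ij}]$ and $S=\mathsf k[d_{ij}]$ ($1\le i,j\le n$). $S$ acts on $R$ by contraction: $\prod d_{ij}^{\alpha_{ij}}\circ\prod a_{ij}^{\beta_{ij}}=\prod a_{ij}^{\beta_{ij}-\alpha_{ij}}$ if $\alpha_{ij}\le\beta_{ij}$ for all $i,j$, and $0$ otherwise, extended $\mathsf k$-bilinearly. For $F\in R$ homogeneous, $\mathrm{Ann}(F)=\{\Phi\in S:\Phi\circ F=0\}$. This action makes $S$ the homogeneous coordinate ring of the projective space $\mathbf P(R_1)$ of 1-dimensional subspaces of $R_1$. For a zero-dimensional closed subscheme $\Gamma\subset\mathbf P(R_1)$ let $I_\Gamma\subset S$ be its (saturated) homogeneous ideal and $\deg\Gamma$ its degree (length). The ranks of $F$ are: the rank $r(F)=\min\{\deg\Gamma : \Gamma\subset\mathbf P(R_1)\text{ smooth},\ \dim\Gamma=0,\ I_\Gamma\subset\mathrm{Ann}(F)\}$; the smoothable rank $sr(F)=\min\{\deg\Gamma : \Gamma\subset\mathbf P(R_1)\text{ smoothable},\ \dim\Gamma=0,\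 I_\Gamma\subset\mathrm{Ann}(F)\}$, where smoothable means being a limit of smooth schemes of $s=\deg\Gamma$ simple points; the cactus rank $cr(F)=\min\{\deg\Gamma : \Gamma\subset\mathbf P(R_1),\ \dim\Gamma=0,\ I_\Gamma\subset\mathrm{Ann}(F)\}$. *)

theory Defs
  imports
    "HOL-Analysis.Determinants"
    "HOL-Algebra.Algebraic_Closure_Type"
    "HOL-Library.Poly_Mapping"
    "HOL-Computational_Algebra.Formal_Laurent_Series"
begin

section \<open>Polynomials in finitely many variables\<close>

text \<open>
  The polynomials over \<open>'k\<close> in the variables \<open>'v\<close>: a polynomial maps exponent vectors to
  coefficients. Both \<open>R = k[a]\<close> and \<open>S = k[d]\<close> are of this type, with the same index set \<open>'v\<close>.
\<close>

type_synonym ('v, 'k) mpoly = "('v \<Rightarrow>\<^sub>0 nat) \<Rightarrow>\<^sub>0 'k"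

definition var :: "'v \<Rightarrow> ('v, 'k::comm_ring_1) mpoly" where
  "var v = Poly_Mapping.single (Poly_Mapping.single v 1) 1"

definition monom_degree :: "('v \<Rightarrow>\<^sub>0 nat) \<Rightarrow> nat" where
  "monom_degree \<alpha> = (\<Sum>v\<in>Poly_Mapping.keys \<alpha>. Poly_Mapping.lookup \<alpha> v)"

definition forms :: "nat \<Rightarrow> ('v, 'k::zero) mpoly set" where
  "forms d = {\<Phi>. \<forall>\<alpha>\<in>Poly_Mapping.keys \<Phi>. monom_degree \<alpha> = d}"

definition hom_component :: "nat \<Rightarrow> ('v, 'k::comm_monoid_add) mpoly \<Rightarrow> ('v, 'k) mpoly" where
  "hom_component d \<Phi> = (\<Sum>\<alpha> | \<alpha> \<in> Poly_Mapping.keys \<Phi> \<and> monom_degree \<alpha> = d.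
     Poly_Mapping.single \<alpha> (Poly_Mapping.lookup \<Phi> \<alpha>))"

definition scale_poly :: "'k::semiring_0 \<Rightarrow> ('v, 'k) mpoly \<Rightarrow> ('v, 'k) mpoly" where
  "scale_poly c = Poly_Mapping.map ((*) c)"

lemma lookup_scale_poly [simp]:
  "Poly_Mapping.lookup (scale_poly c \<Phi>) \<alpha> = c * Poly_Mapping.lookup \<Phi> \<alpha>"
  by (simp add: scale_poly_def Poly_Mapping.map.rep_eq when_def)

global_interpretation mpoly: vector_space "scale_poly :: 'k::field \<Rightarrow> ('v, 'k) mpoly \<Rightarrow> _"
  by unfold_locales
    (rule poly_mapping_eqI, simp add: lookup_add algebra_simps)+

text \<open>
  The ideals of a commutative ring are its submodules, so \<open>self_module.subspace I\<close> states that
  \<open>I\<close> is an ideal and \<open>self_module.span X\<close> is the ideal generated by \<open>X\<close>.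
\<close>

global_interpretation self_module: Modules.module "(*) :: 'r::comm_ring_1 \<Rightarrow> 'r \<Rightarrow> 'r"
  by unfold_locales (auto simp: algebra_simps)


section \<open>Apolarity\<close>

definition contract :: "('v, 'k::comm_ring_1) mpoly \<Rightarrow> ('v, 'k) mpoly \<Rightarrow> ('v, 'k) mpoly" where
  "contract \<Phi> F = (\<Sum>\<alpha>\<in>Poly_Mapping.keys \<Phi>. \<Sum>\<beta>\<in>Poly_Mapping.keys F.
     if \<forall>v. Poly_Mapping.lookup \<alpha> v \<le> Poly_Mapping.lookup \<beta> v
     then Poly_Mapping.single (\<beta> - \<alpha>) (Poly_Mapping.lookup \<Phi> \<alpha> * Poly_Mapping.lookup F \<beta>)
     else 0)"

definition Ann :: "('v, 'k::comm_ring_1) mpoly \<Rightarrow> ('v, 'k) mpoly set" where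
  "Ann F = {\<Phi>. contract \<Phi> F = 0}"


section \<open>Zero-dimensional subschemes of projective space\<close>

text \<open>
  Closed subschemes \<open>\<Gamma>\<close> of the projective space with homogeneous coordinate ring \<open>S\<close> correspond
  bijectively to the saturated homogeneous ideals \<open>I\<close> of \<open>S\<close>, and \<open>\<Gamma>\<close> is represented by \<open>I\<close>.
  The whole ring \<open>S\<close> represents the empty scheme.
\<close>

definition saturation :: "('v, 'k::comm_ring_1) mpoly set \<Rightarrow> ('v, 'k) mpoly set" where
  "saturation I = {\<Phi>. \<exists>m. \<forall>\<Psi>\<in>forms m. \<Psi> * \<Phi> \<in> I}"

definition proj_subscheme :: "('v, 'k::comm_ring_1) mpoly set \<Rightarrow> bool" where
  "proj_subscheme I \<longleftrightarrow>
     self_module.subspace I \<and> (\<forall>\<Phi>\<in>I. \<forall>d. hom_component d \<Phi> \<in> I) \<and> saturation I = I"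

text \<open>
  The dimension of the degree \<open>d\<close> part of \<open>S / I\<close>. The truncated subtraction is harmless, as
  \<open>forms d\<close> is finite-dimensional for finite \<open>'v\<close>.
\<close>

definition hilbert_function :: "('v::finite, 'k::field) mpoly set \<Rightarrow> nat \<Rightarrow> nat" where
  "hilbert_function I d =
     mpoly.dim (forms d :: ('v, 'k) mpoly set) - mpoly.dim (I \<inter> forms d)"

text \<open>
  \<open>\<Gamma>\<close> has dimension zero and degree \<open>s\<close> iff its Hilbert polynomial is the nonzero constant \<open>s\<close>.
\<close>

definition zero_dim_subscheme :: "('v::finite, 'k::field) mpoly set \<Rightarrow> bool" where
  "zero_dim_subscheme I \<longleftrightarrow> proj_subscheme I \<and>
     (\<exists>s>0. eventually (\<lambda>d. hilbert_function I d = s) sequentially)"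

definition scheme_degree :: "('v::finite, 'k::field) mpoly set \<Rightarrow> nat" where
  "scheme_degree I = (THE s. eventually (\<lambda>d. hilbert_function I d = s) sequentially)"

text \<open>
  The ideal of the base change of \<open>\<Gamma>\<close> to the algebraic closure of the ground field.
\<close>

definition geometric_ideal :: "('v, 'k::field) mpoly set \<Rightarrow> ('v, 'k alg_closure) mpoly set" where
  "geometric_ideal I = self_module.span (Poly_Mapping.map to_ac ` I)"

text \<open>
  A scheme of finite type over a field is smooth iff it is geometrically regular; in dimension zero,
  regular means reduced. The base change of a saturated ideal is saturated, and a saturated ideal
  defines a reduced scheme iff it is a radical ideal.
\<close>

definition smooth_zero_dim :: "('v::finite, 'k::field) mpoly set \<Rightarrow> bool" where
  "smooth_zero_dim I \<longleftrightarrow> zero_dim_subscheme I \<and>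
     (\<forall>\<Phi> m. \<Phi> ^ m \<in> geometric_ideal I \<longrightarrow> \<Phi> \<in> geometric_ideal I)"

text \<open>
  Let \<open>J\<close> define a closed subscheme over \<open>K((t))\<close>. The polynomials over \<open>K[[t]]\<close> that lie in \<open>J\<close>
  define its closure in the projective space over \<open>K[[t]]\<close>, which is the unique flat
  extension. Its fibre over \<open>t = 0\<close> is the limit.
\<close>

definition limit_ideal :: "('v, 'k::field fls) mpoly set \<Rightarrow> ('v, 'k) mpoly set" where
  "limit_ideal J = saturation
     {Poly_Mapping.map (\<lambda>f. fps_nth f 0) \<Phi> | \<Phi> :: ('v, 'k fps) mpoly.
        Poly_Mapping.map fps_to_fls \<Phi> \<in> J}"

text \<open>
  \<open>\<Gamma>\<close> is smoothable iff its point lies in the closure of the smooth locus of the Hilbert scheme.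
  The smooth locus and its closure commute with extension of the ground field \<open>k\<close>. Over the algebraic
  closure \<open>K\<close> of \<open>k\<close>, a point of the closure is the limit of a point of the smooth locus
  with values in \<open>K((t))\<close>. Without passing to \<open>K\<close> this would fail, since over \<open>k\<close> such an arc
  need not exist.
\<close>

definition smoothable :: "('v::finite, 'k::field) mpoly set \<Rightarrow> bool" where
  "smoothable I \<longleftrightarrow> zero_dim_subscheme I \<and>
     (\<exists>J :: ('v, 'k alg_closure fls) mpoly set.
        smooth_zero_dim J \<and> scheme_degree J = scheme_degree I \<and>
        limit_ideal J = geometric_ideal I)"


section \<open>Ranks\<close>

text \<open>
  The minima are taken in the natural numbers, where \<open>Inf {} = 0\<close>. A positive lower bound
  for one of these ranks therefore includes the claim that the minimum exists.
\<close>

definition form_rank :: "('v::finite, 'k::field) mpoly \<Rightarrow> nat" where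
  "form_rank F = Inf {scheme_degree I | I. smooth_zero_dim I \<and> I \<subseteq> Ann F}"

definition smoothable_rank :: "('v::finite, 'k::field) mpoly \<Rightarrow> nat" where
  "smoothable_rank F = Inf {scheme_degree I | I. smoothable I \<and> I \<subseteq> Ann F}"

definition cactus_rank :: "('v::finite, 'k::field) mpoly \<Rightarrow> nat" where
  "cactus_rank F = Inf {scheme_degree I | I. zero_dim_subscheme I \<and> I \<subseteq> Ann F}"


section \<open>The generic matrix\<close>

definition generic_matrix :: "('n::finite \<times> 'n, 'k::comm_ring_1) mpoly ^ 'n ^ 'n" where
  "generic_matrix = (\<chi> i j. var (i, j))"

definition permanent :: "'a::comm_ring_1 ^ 'n ^ 'n \<Rightarrow> 'a" where
  "permanent A = (\<Sum>\<sigma> | \<sigma> permutes (UNIV :: 'n set). \<Prod>i\<in>UNIV. A $ i $ \<sigma> i)"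

end

theory Submission
  imports Defs
begin

text \<open>
  Let \<open>I\<close> define a zero-dimensional scheme of degree \<open>s\<close> and let \<open>I \<subseteq> Ann F\<close>. All squares
  \<open>d\<^sub>i\<^sub>j\<^sup>2\<close> annihilate \<open>F\<close> and they have no common zero, so over an algebraically closed field some
  linear combination \<open>g\<close> of them is a nonzerodivisor on \<open>S / I\<close>. Then
  \<open>dim (S / (I + g S))\<close> telescopes to \<open>2 s\<close>, and it is at least \<open>dim (S / Ann F)\<close>, which is at least
  \<open>\<Sum>d. (n choose d)\<^sup>2 = (2 n choose n)\<close>, the number of minors of the generic matrix. The scheme need
  not have rational points, so the ground field is extended first; membership in an extended ideal is
  tested by applying linear functionals to the coefficients.

  Over an algebraically closed field, a smooth zero-dimensional scheme is given by the ideal of all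
  forms that vanish at its points. Such an ideal remains radical after every field extension, so the
  constant family over the Laurent series shows that the scheme is smoothable.

  All ranks are finite because, outside characteristic two, \<open>x\<^sub>1 \<cdots> x\<^sub>n\<close> is a combination of the
  powers \<open>(\<plusminus> x\<^sub>1 \<plusminus> \<cdots> \<plusminus> x\<^sub>n)\<^sup>n\<close>, read as divided powers.
\<close>

text \<open>The quotient by \<open>g\<close> is never formed. Write H for the Hilbert function of
  \<open>I\<close>. Multiplying a basis modulo \<open>I\<close> in degree d by \<open>g\<close> and
  adjoining the monomials of the minors of size d + 2 gives H(d+2) >= H(d) + (n choose d+2)^2. Since
  \<open>g\<close> has degree 2, only the sum of two consecutive values of H collects all the
  squares; this is the source of the factor 1/2. To be a nonzerodivisor, \<open>g\<close> must avoid
  finitely many points, which is why a Nullstellensatz in dimension zero is needed. It comes from a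
  prime ideal that misses a prescribed element. Points are treated as vectors p, and a polynomial is
  restricted to the line through p, which keeps its homogeneous components apart. For the upper
  bound, contraction involves no factorials. Apolarity reduces to the vanishing of certain
  coefficients of the members of the ideal, and extracting such a coefficient by a sum over signs
  costs only a power of 2.\<close>

text \<open>For multiplication as scalar multiplication, this simplification rule reverses associativity.\<close>

declare self_module.scale_scale [simp del]


section \<open>Coefficients and monomials\<close>

abbreviation mon :: "('v \<Rightarrow>\<^sub>0 nat) \<Rightarrow> ('v, 'k::comm_ring_1) mpoly" where
  "mon \<alpha> \<equiv> Poly_Mapping.single \<alpha> 1"

lemma lookup_map_zero:
  "f 0 = 0 \<Longrightarrow> Poly_Mapping.lookup (Poly_Mapping.map f \<Phi>) \<alpha> = f (Poly_Mapping.lookup \<Phi> \<alpha>)"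
  by (simp add: Poly_Mapping.map.rep_eq when_def)

lemma poly_mapping_sum_single:
  "(\<Sum>\<alpha>\<in>Poly_Mapping.keys \<Phi>. Poly_Mapping.single \<alpha> (Poly_Mapping.lookup \<Phi> \<alpha>)) = \<Phi>"
  by (rule poly_mapping_eqI)
    (simp add: lookup_sum lookup_single when_def in_keys_iff)

text \<open>Reduces linear and bilinear identities to single terms. The step for sums has no
  disjointness condition, so plain additivity closes it.\<close>

lemma poly_mapping_single_add_induct [case_names single add]:
  fixes \<Phi> :: "'a \<Rightarrow>\<^sub>0 'b::comm_monoid_add"
  assumes "\<And>\<alpha> c. P (Poly_Mapping.single \<alpha> c)" and "\<And>f g. P f \<Longrightarrow> P g \<Longrightarrow> P (f + g)"
  shows "P \<Phi>"
proof -
  have "P (\<Sum>\<alpha>\<in>A. Poly_Mapping.single \<alpha> (Poly_Mapping.lookup \<Phi> \<alpha>))" if "finite A" for A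
    using that
  proof induction
    case empty
    show ?case using assms(1)[of undefined 0] by simp
  qed (simp add: assms)
  from this[of "Poly_Mapping.keys \<Phi>"] show ?thesis by (simp add: poly_mapping_sum_single)
qed

lemma scale_poly_conv_mult: "scale_poly c \<Phi> = Poly_Mapping.single 0 c * \<Phi>"
  unfolding scale_poly_def by (rule mult_map_scale_conv_mult)

lemma scale_poly_single [simp]:
  "scale_poly c (Poly_Mapping.single \<alpha> a) = Poly_Mapping.single \<alpha> (c * a)"
  by (simp add: scale_poly_conv_mult mult_single)

lemma mult_scale_poly_right: 
  fixes \<Phi> \<Psi> :: "('v, 'k::comm_ring_1) mpoly"
  shows "\<Phi> * scale_poly c \<Psi> = scale_poly c (\<Phi> * \<Psi>)"
  unfolding scale_poly_conv_mult by (rule mult.left_commute)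

lemma mult_scale_poly_left: 
  fixes \<Phi> \<Psi> :: "('v, 'k::comm_ring_1) mpoly"
  shows "scale_poly c \<Phi> * \<Psi> = scale_poly c (\<Phi> * \<Psi>)"
  unfolding scale_poly_conv_mult by (rule mult.assoc)

lemma monom_degree_UNIV:
  fixes \<alpha> :: "'v::finite \<Rightarrow>\<^sub>0 nat"
  shows "monom_degree \<alpha> = (\<Sum>v\<in>UNIV. Poly_Mapping.lookup \<alpha> v)"
  unfolding monom_degree_def by (rule sum.mono_neutral_left) (auto simp: in_keys_iff)

lemma monom_degree_add:
  fixes \<alpha> \<beta> :: "'v::finite \<Rightarrow>\<^sub>0 nat"
  shows "monom_degree (\<alpha> + \<beta>) = monom_degree \<alpha> + monom_degree \<beta>"
  by (simp add: monom_degree_UNIV lookup_add sum.distrib)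

lemma monom_degree_0 [simp]: "monom_degree 0 = 0"
  by (simp add: monom_degree_def)

lemma monom_degree_single [simp]: "monom_degree (Poly_Mapping.single v k) = k"
  by (simp add: monom_degree_def)

lemma mem_forms_iff:
  "\<Phi> \<in> forms d \<longleftrightarrow> (\<forall>\<alpha>. monom_degree \<alpha> \<noteq> d \<longrightarrow> Poly_Mapping.lookup \<Phi> \<alpha> = 0)"
  by (auto simp: forms_def in_keys_iff)

lemma zero_mem_forms [simp]: "0 \<in> forms d"
  by (simp add: forms_def)

lemma single_mem_forms [simp]: "monom_degree \<alpha> = d \<Longrightarrow> Poly_Mapping.single \<alpha> c \<in> forms d"
  by (simp add: forms_def)

lemma forms_add:
  fixes \<Phi> :: "('v, 'k::comm_ring_1) mpoly"
  shows "\<Phi> \<in> forms d \<Longrightarrow> \<Psi> \<in> forms d \<Longrightarrow> \<Phi> + \<Psi> \<in> forms d"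
  by (simp add: mem_forms_iff lookup_add)

lemma forms_scale: "\<Phi> \<in> forms d \<Longrightarrow> scale_poly c \<Phi> \<in> forms d"
  by (simp add: mem_forms_iff)

lemma forms_sum:
  fixes f :: "'i \<Rightarrow> ('v, 'k::comm_ring_1) mpoly"
  shows "(\<And>i. i \<in> A \<Longrightarrow> f i \<in> forms d) \<Longrightarrow> (\<Sum>i\<in>A. f i) \<in> forms d"
  by (simp add: mem_forms_iff lookup_sum)

lemma forms_mult:
  fixes \<Phi> \<Psi> :: "('v::finite, 'k::comm_ring_1) mpoly"
  assumes "\<Phi> \<in> forms d" "\<Psi> \<in> forms e"
  shows "\<Phi> * \<Psi> \<in> forms (d + e)"
  using keys_mult[of \<Phi> \<Psi>] assms unfolding forms_def by (force simp: monom_degree_add)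

lemma one_mem_forms [simp]: "1 \<in> (forms 0 :: ('v, 'k::comm_ring_1) mpoly set)"
  by (simp add: forms_def)

lemma forms_power:
  fixes \<Phi> :: "('v::finite, 'k::comm_ring_1) mpoly"
  shows "\<Phi> \<in> forms d \<Longrightarrow> \<Phi> ^ m \<in> forms (m * d)"
  by (induction m) (auto intro: forms_mult)

lemma var_mem_forms [simp]: "var v \<in> forms 1"
  by (simp add: var_def)

lemma subspace_forms: "mpoly.subspace (forms d)"
  by (auto simp: mpoly.subspace_def forms_add forms_scale)

lemma lookup_hom_component:
  "Poly_Mapping.lookup (hom_component d \<Phi>) \<alpha> =
     (if monom_degree \<alpha> = d then Poly_Mapping.lookup \<Phi> \<alpha> else 0)"
proof -
  have fin: "finite {\<alpha> \<in> Poly_Mapping.keys \<Phi>. monom_degree \<alpha> = d}" by simp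
  show ?thesis
    unfolding hom_component_def lookup_sum
    by (simp add: lookup_single when_def sum.delta[OF fin] in_keys_iff)
qed

lemma hom_component_mem_forms [simp]: "hom_component d \<Phi> \<in> forms d"
  by (simp add: mem_forms_iff lookup_hom_component)

lemma sum_hom_component:
  fixes \<Phi> :: "('v, 'k::comm_ring_1) mpoly"
  shows "(\<Sum>d\<in>monom_degree ` Poly_Mapping.keys \<Phi>. hom_component d \<Phi>) = \<Phi>"
  by (rule poly_mapping_eqI) (auto simp: lookup_sum lookup_hom_component in_keys_iff)

lemma hom_component_forms:
  "\<Phi> \<in> forms e \<Longrightarrow> hom_component d \<Phi> = (if d = e then \<Phi> else 0)"
  by (rule poly_mapping_eqI) (auto simp: lookup_hom_component mem_forms_iff)

text \<open>Cancellation may make the support of the sum smaller than the union of the supports; the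
  terms lost in this way contribute zero.\<close>

lemma sum_keys_add:
  fixes G :: "'a \<Rightarrow> 'k::comm_ring_1 \<Rightarrow> 'b::comm_monoid_add"
  assumes "\<And>\<alpha>. G \<alpha> 0 = 0" and "\<And>\<alpha> a b. G \<alpha> (a + b) = G \<alpha> a + G \<alpha> b"
  shows "(\<Sum>\<alpha>\<in>Poly_Mapping.keys (\<Phi> + \<Psi>). G \<alpha> (Poly_Mapping.lookup (\<Phi> + \<Psi>) \<alpha>)) =
    (\<Sum>\<alpha>\<in>Poly_Mapping.keys \<Phi>. G \<alpha> (Poly_Mapping.lookup \<Phi> \<alpha>)) +
    (\<Sum>\<alpha>\<in>Poly_Mapping.keys \<Psi>. G \<alpha> (Poly_Mapping.lookup \<Psi> \<alpha>))"
  using setsum_keys_plus_distrib[of G \<Phi> \<Psi>] assms by auto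

lemma var_power: "var v ^ m = (mon (Poly_Mapping.single v m) :: ('v, 'k::comm_ring_1) mpoly)"
  by (induction m) (auto simp: var_def mult_single single_add[symmetric])

lemma mon_eq_prod_var:
  fixes \<alpha> :: "'v::finite \<Rightarrow>\<^sub>0 nat"
  shows "(mon \<alpha> :: ('v, 'k::comm_ring_1) mpoly) = (\<Prod>v\<in>UNIV. var v ^ Poly_Mapping.lookup \<alpha> v)"
proof -
  have "(\<Prod>v\<in>A. (var v :: ('v, 'k) mpoly) ^ Poly_Mapping.lookup \<alpha> v) =
      mon (\<Sum>v\<in>A. Poly_Mapping.single v (Poly_Mapping.lookup \<alpha> v))" if "finite A" for A
    using that by induction (auto simp: var_power mult_single)
  from this[of UNIV] have "(\<Prod>v\<in>UNIV. (var v :: ('v, 'k) mpoly) ^ Poly_Mapping.lookup \<alpha> v) =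
      mon (\<Sum>v\<in>UNIV. Poly_Mapping.single v (Poly_Mapping.lookup \<alpha> v))" by simp
  also have "(\<Sum>v\<in>UNIV. Poly_Mapping.single v (Poly_Mapping.lookup \<alpha> v)) = \<alpha>"
    by (rule poly_mapping_eqI) (simp add: lookup_sum lookup_single when_def)
  finally show ?thesis by simp
qed

lemma ideal_scale:
  fixes \<Phi> :: "('v, 'k::comm_ring_1) mpoly"
  shows
  "self_module.subspace I \<Longrightarrow> \<Phi> \<in> I \<Longrightarrow> scale_poly c \<Phi> \<in> I"
  unfolding scale_poly_conv_mult by (rule self_module.subspace_scale)

lemma ideal_scale_iff:
  fixes \<Phi> :: "('v, 'k::field) mpoly"
  assumes "self_module.subspace I" "c \<noteq> 0"
  shows "scale_poly c \<Phi> \<in> I \<longleftrightarrow> \<Phi> \<in> I"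
proof
  assume "scale_poly c \<Phi> \<in> I"
  from ideal_scale[OF assms(1) this, of "inverse c"] show "\<Phi> \<in> I" using assms(2) by simp
qed (simp add: ideal_scale assms)

lemma homogeneous_ideal_eqI:
  fixes I J :: "('v, 'k::comm_ring_1) mpoly set"
  assumes "self_module.subspace J" and "\<And>\<Phi> d. \<Phi> \<in> I \<Longrightarrow> hom_component d \<Phi> \<in> J"
  shows "I \<subseteq> J"
proof
  fix \<Phi> assume "\<Phi> \<in> I"
  with assms have "(\<Sum>d\<in>monom_degree ` Poly_Mapping.keys \<Phi>. hom_component d \<Phi>) \<in> J"
    by (intro self_module.subspace_sum) auto
  then show "\<Phi> \<in> J" by (simp add: sum_hom_component)
qed

text \<open>Every factor is a sum of single terms. For extended ideals only such factors are easy to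
  treat, because their coefficient can be absorbed into a linear functional.\<close>

lemma self_module_subspaceI:
  fixes I :: "('v, 'k::comm_ring_1) mpoly set"
  assumes "0 \<in> I" "\<And>\<Phi> \<Psi>. \<Phi> \<in> I \<Longrightarrow> \<Psi> \<in> I \<Longrightarrow> \<Phi> + \<Psi> \<in> I"
    and single: "\<And>\<alpha> c \<Phi>. \<Phi> \<in> I \<Longrightarrow> Poly_Mapping.single \<alpha> c * \<Phi> \<in> I"
  shows "self_module.subspace I"
proof -
  have "\<Psi> * \<Phi> \<in> I" if "\<Phi> \<in> I" for \<Psi> \<Phi>
    by (induction \<Psi> rule: poly_mapping_single_add_induct)
      (use assms that in \<open>auto simp: distrib_right\<close>)
  with assms show ?thesis by (auto simp: self_module.subspace_def)
qed


section \<open>Restriction to lines through the origin\<close>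

definition mon_eval :: "('v::finite \<Rightarrow> 'k::comm_ring_1) \<Rightarrow> ('v \<Rightarrow>\<^sub>0 nat) \<Rightarrow> 'k" where
  "mon_eval p \<alpha> = (\<Prod>v\<in>UNIV. p v ^ Poly_Mapping.lookup \<alpha> v)"

lemma mon_eval_add: "mon_eval p (\<alpha> + \<beta>) = mon_eval p \<alpha> * mon_eval p \<beta>"
  by (simp add: mon_eval_def lookup_add power_add prod.distrib)

lemma mon_eval_0 [simp]: "mon_eval p 0 = 1"
  by (simp add: mon_eval_def)

lemma mon_eval_single [simp]: "mon_eval p (Poly_Mapping.single v k) = p v ^ k"
proof -
  have "mon_eval p (Poly_Mapping.single v k) = (\<Prod>w\<in>UNIV. if w = v then p v ^ k else 1)"
    unfolding mon_eval_def by (intro prod.cong) (auto simp: lookup_single when_def)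
  then show ?thesis by simp
qed

text \<open>
  The univariate polynomial \<open>\<Phi>(t p)\<close>. It is multiplicative in \<open>\<Phi>\<close>, and its coefficients are the
  values at \<open>p\<close> of the homogeneous components of \<open>\<Phi>\<close>.
\<close>

definition line_eval :: "('v::finite \<Rightarrow> 'k::comm_ring_1) \<Rightarrow> ('v, 'k) mpoly \<Rightarrow> 'k poly" where
  "line_eval p \<Phi> = (\<Sum>\<alpha>\<in>Poly_Mapping.keys \<Phi>.
     monom (Poly_Mapping.lookup \<Phi> \<alpha> * mon_eval p \<alpha>) (monom_degree \<alpha>))"

lemma line_eval_add: "line_eval p (\<Phi> + \<Psi>) = line_eval p \<Phi> + line_eval p \<Psi>"
  unfolding line_eval_def by (rule sum_keys_add) (auto simp: algebra_simps add_monom)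

lemma line_eval_single [simp]:
  "line_eval p (Poly_Mapping.single \<alpha> c) = monom (c * mon_eval p \<alpha>) (monom_degree \<alpha>)"
  by (simp add: line_eval_def)

lemma line_eval_0 [simp]: "line_eval p 0 = 0"
  by (simp add: line_eval_def)

lemma line_eval_1 [simp]: "line_eval p 1 = 1"
  using line_eval_single[of p 0 1] by (simp add: one_pCons monom_0)

lemma line_eval_var [simp]: "line_eval p (var v) = monom (p v) 1"
  by (simp add: var_def)

lemma line_eval_sum: "line_eval p (\<Sum>i\<in>A. f i) = (\<Sum>i\<in>A. line_eval p (f i))"
  by (induction A rule: infinite_finite_induct) (auto simp: line_eval_add)

lemma line_eval_mult: "line_eval p (\<Phi> * \<Psi>) = line_eval p \<Phi> * line_eval p \<Psi>"
proof (induction \<Phi> rule: poly_mapping_single_add_induct)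
  case (single \<alpha> c)
  show ?case
  proof (induction \<Psi> rule: poly_mapping_single_add_induct)
    case (single \<beta> a)
    have "c * a * (mon_eval p \<alpha> * mon_eval p \<beta>) = c * mon_eval p \<alpha> * (a * mon_eval p \<beta>)"
      by (simp add: mult_ac)
    then show ?case by (simp add: mult_single mult_monom mon_eval_add monom_degree_add)
  qed (simp add: distrib_left line_eval_add)
qed (simp add: distrib_right line_eval_add)

lemma line_eval_power: "line_eval p (\<Phi> ^ m) = line_eval p \<Phi> ^ m"
  by (induction m) (auto simp: line_eval_mult)

lemma coeff_line_eval:
  "coeff (line_eval p \<Phi>) d =
     (\<Sum>\<alpha> | \<alpha> \<in> Poly_Mapping.keys \<Phi> \<and> monom_degree \<alpha> = d. Poly_Mapping.lookup \<Phi> \<alpha> * mon_eval p \<alpha>)"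
proof -
  have "coeff (line_eval p \<Phi>) d = (\<Sum>\<alpha>\<in>Poly_Mapping.keys \<Phi>.
      if monom_degree \<alpha> = d then Poly_Mapping.lookup \<Phi> \<alpha> * mon_eval p \<alpha> else 0)"
    by (simp add: line_eval_def coeff_sum)
  then show ?thesis by (simp add: sum.inter_filter)
qed

lemma line_eval_forms:
  assumes "\<Phi> \<in> forms d"
  shows "line_eval p \<Phi> = monom (coeff (line_eval p \<Phi>) d) d"
proof (rule poly_eqI)
  fix e
  show "coeff (line_eval p \<Phi>) e = coeff (monom (coeff (line_eval p \<Phi>) d) d) e"
  proof (cases "e = d")
    case False
    with assms have "{\<alpha> \<in> Poly_Mapping.keys \<Phi>. monom_degree \<alpha> = e} = {}"
      by (auto simp: forms_def)
    with False show ?thesis by (simp only: coeff_line_eval) simp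
  qed simp
qed

lemma line_eval_hom_component:
  "line_eval p (hom_component d \<Phi>) = monom (coeff (line_eval p \<Phi>) d) d"
proof -
  have "{\<alpha> \<in> Poly_Mapping.keys (hom_component d \<Phi>). monom_degree \<alpha> = d} =
      {\<alpha> \<in> Poly_Mapping.keys \<Phi>. monom_degree \<alpha> = d}"
    by (auto simp: in_keys_iff lookup_hom_component)
  then have "coeff (line_eval p (hom_component d \<Phi>)) d = coeff (line_eval p \<Phi>) d"
    unfolding coeff_line_eval by (simp add: lookup_hom_component)
  then show ?thesis using line_eval_forms[OF hom_component_mem_forms[of d \<Phi>], of p] by simp
qed

text \<open>Vanishing of the whole polynomial in t means that every homogeneous component vanishes
  at p. For nonzero vectors this is the homogeneous ideal of the projective points that they
  span.\<close>

definition cone_ideal :: "('v::finite \<Rightarrow> 'k::comm_ring_1) set \<Rightarrow> ('v, 'k) mpoly set" where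
  "cone_ideal V = {\<Phi>. \<forall>p\<in>V. line_eval p \<Phi> = 0}"

lemma cone_ideal_subspace: "self_module.subspace (cone_ideal V)"
  by (auto simp: self_module.subspace_def cone_ideal_def line_eval_add line_eval_mult)

lemma cone_ideal_homogeneous: "\<Phi> \<in> cone_ideal V \<Longrightarrow> hom_component d \<Phi> \<in> cone_ideal V"
  by (simp add: cone_ideal_def line_eval_hom_component)

lemma cone_ideal_radical:
  fixes V :: "('v::finite \<Rightarrow> 'k::idom) set"
  shows "\<Phi> ^ m \<in> cone_ideal V \<Longrightarrow> \<Phi> \<in> cone_ideal V"
  by (auto simp: cone_ideal_def line_eval_power)


section \<open>Hilbert functions\<close>

text \<open>Indexed families can be mapped, multiplied by a form and concatenated without proving
  injectivity first; for an ideal, injectivity follows from independence.\<close>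

definition indep_mod :: "('v, 'k::field) mpoly set \<Rightarrow> ('i \<Rightarrow> ('v, 'k) mpoly) \<Rightarrow> 'i set \<Rightarrow> bool" where
  "indep_mod I b J \<longleftrightarrow> (\<forall>c. (\<Sum>j\<in>J. scale_poly (c j) (b j)) \<in> I \<longrightarrow> (\<forall>j\<in>J. c j = 0))"

lemma indep_modD: "indep_mod I b J \<Longrightarrow> (\<Sum>j\<in>J. scale_poly (c j) (b j)) \<in> I \<Longrightarrow> j \<in> J \<Longrightarrow> c j = 0"
  unfolding indep_mod_def by blast

definition spans_mod ::
    "('v, 'k::field) mpoly set \<Rightarrow> ('i \<Rightarrow> ('v, 'k) mpoly) \<Rightarrow> 'i set \<Rightarrow> ('v, 'k) mpoly set \<Rightarrow> bool" where
  "spans_mod I b J V \<longleftrightarrow> (\<forall>\<Phi>\<in>V. \<exists>c. \<Phi> - (\<Sum>j\<in>J. scale_poly (c j) (b j)) \<in> I)"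

lemma finite_monom_degree: "finite {\<alpha> :: 'v::finite \<Rightarrow>\<^sub>0 nat. monom_degree \<alpha> = d}"
proof (rule inj_on_finite)
  show "inj_on Poly_Mapping.lookup {\<alpha> :: 'v \<Rightarrow>\<^sub>0 nat. monom_degree \<alpha> = d}"
    by (intro inj_onI) (rule poly_mapping_eqI, erule fun_cong)
  show "Poly_Mapping.lookup ` {\<alpha> :: 'v \<Rightarrow>\<^sub>0 nat. monom_degree \<alpha> = d} \<subseteq> PiE UNIV (\<lambda>_. {..d})"
  proof safe
    fix \<alpha> :: "'v \<Rightarrow>\<^sub>0 nat" and v
    show "Poly_Mapping.lookup \<alpha> v \<le> monom_degree \<alpha>"
      unfolding monom_degree_UNIV by (rule member_le_sum) simp_all
  qed simp_all
  show "finite (PiE (UNIV :: 'v set) (\<lambda>_. {..d}))" by (intro finite_PiE) auto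
qed

lemma forms_subset_span:
  "(forms d :: ('v::finite, 'k::field) mpoly set) \<subseteq> mpoly.span (mon ` {\<alpha>. monom_degree \<alpha> = d})"
proof
  fix \<Phi> :: "('v, 'k) mpoly" assume "\<Phi> \<in> forms d"
  then have "(\<Sum>\<alpha>\<in>Poly_Mapping.keys \<Phi>. scale_poly (Poly_Mapping.lookup \<Phi> \<alpha>) (mon \<alpha>)) \<in>
      mpoly.span (mon ` {\<alpha>. monom_degree \<alpha> = d})"
    by (intro mpoly.span_sum mpoly.span_scale mpoly.span_base) (auto simp: forms_def)
  then show "\<Phi> \<in> mpoly.span (mon ` {\<alpha>. monom_degree \<alpha> = d})"
    by (simp add: poly_mapping_sum_single)
qed

text \<open>A basis \<open>B\<close> of the degree d part of the ideal is extended to a basis of all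
  forms of degree d, and \<open>C\<close> consists of the new elements. The cardinalities show that
  the truncated subtraction is a true difference.\<close>

lemma hilbert_function_adapted_basis:
  fixes I :: "('v::finite, 'k::field) mpoly set"
  assumes "self_module.subspace I"
  obtains B C where "B \<subseteq> I \<inter> forms d" "I \<inter> forms d \<subseteq> mpoly.span B" "C \<subseteq> forms d"
    "forms d \<subseteq> mpoly.span (B \<union> C)" "mpoly.independent (B \<union> C)" "B \<inter> C = {}" "finite B" "finite C"
    "card B = mpoly.dim (I \<inter> forms d)" "card C = hilbert_function I d"
    "card B + card C = mpoly.dim (forms d :: ('v, 'k) mpoly set)"
proof -
  have fin: "finite S" if "mpoly.independent S" "S \<subseteq> forms d" for S :: "('v, 'k) mpoly set"
    using mpoly.independent_span_bound[OF _ that(1), of "mon ` {\<alpha>. monom_degree \<alpha> = d}"]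
      that(2) forms_subset_span[of d] finite_monom_degree[of d] by auto
  obtain B where B: "B \<subseteq> I \<inter> forms d" "mpoly.independent B" "I \<inter> forms d \<subseteq> mpoly.span B"
    "card B = mpoly.dim (I \<inter> forms d)"
    by (rule mpoly.basis_exists)
  obtain D where D: "B \<subseteq> D" "D \<subseteq> forms d" "mpoly.independent D" "forms d \<subseteq> mpoly.span D"
    using mpoly.maximal_independent_subset_extend[of B "forms d"] B by auto
  have finD: "finite D" using fin D by blast
  have cD: "card D = mpoly.dim (forms d :: ('v, 'k) mpoly set)"
    by (rule mpoly.basis_card_eq_dim) (use D in auto)
  have finB: "finite B" using finD D(1) by (rule rev_finite_subset)
  have cDB: "card (D - B) = card D - card B" by (rule card_Diff_subset[OF finB D(1)])
  have le: "card B \<le> card D" by (rule card_mono[OF finD D(1)])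
  show ?thesis
    by (rule that[of B "D - B"])
      (use B D finB finD cD cDB le in \<open>auto simp: hilbert_function_def Un_absorb1\<close>)
qed

lemma span_finite_sum:
  "finite B \<Longrightarrow> x \<in> mpoly.span B \<Longrightarrow> \<exists>u. x = (\<Sum>v\<in>B. scale_poly (u v) v)"
  by (auto simp: mpoly.span_finite)

text \<open>The complement \<open>C\<close> of an adapted basis, numbered from 0, is a basis of the
  degree d part of the quotient.\<close>

lemma hilbert_function_basis:
  fixes I :: "('v::finite, 'k::field) mpoly set"
  assumes I: "self_module.subspace I"
  obtains b :: "nat \<Rightarrow> ('v, 'k) mpoly" where "\<And>j. j < hilbert_function I d \<Longrightarrow> b j \<in> forms d"
    "indep_mod I b {..<hilbert_function I d}" "spans_mod I b {..<hilbert_function I d} (forms d)"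
proof -
  obtain B C where BC: "B \<subseteq> I \<inter> forms d" "I \<inter> forms d \<subseteq> mpoly.span B" "C \<subseteq> forms d"
    "forms d \<subseteq> mpoly.span (B \<union> C)" "mpoly.independent (B \<union> C)" "B \<inter> C = {}" "finite B" "finite C"
    "card C = hilbert_function I d"
    by (rule hilbert_function_adapted_basis[OF I, where d = d])
  obtain b where b: "bij_betw b {..<hilbert_function I d} C"
    using ex_bij_betw_nat_finite[OF BC(8)] BC(9) by (auto simp: atLeast0LessThan)
  have bC: "b j \<in> C" if "j < hilbert_function I d" for j
    using b that by (auto simp: bij_betw_def)
  have inj: "inj_on b {..<hilbert_function I d}" and im: "b ` {..<hilbert_function I d} = C"
    using b by (auto simp: bij_betw_def)
  show ?thesis
  proof (rule that[of b])
    show "b j \<in> forms d" if "j < hilbert_function I d" for j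
      using bC[OF that] BC(3) by blast
    show "indep_mod I b {..<hilbert_function I d}"
      unfolding indep_mod_def
    proof (intro allI impI ballI)
      fix c j assume s: "(\<Sum>j<hilbert_function I d. scale_poly (c j) (b j)) \<in> I" and j: "j \<in> {..<hilbert_function I d}"
      define c' where "c' v = c (the_inv_into {..<hilbert_function I d} b v)" for v
      have c': "c' (b i) = c i" if "i < hilbert_function I d" for i
        using that inj by (simp add: c'_def the_inv_into_f_f)
      have eq: "(\<Sum>j<hilbert_function I d. scale_poly (c j) (b j)) = (\<Sum>v\<in>C. scale_poly (c' v) v)"
        unfolding im[symmetric] by (subst sum.reindex[OF inj]) (auto simp: c')
      have "(\<Sum>v\<in>C. scale_poly (c' v) v) \<in> forms d"
        using BC(3) by (intro forms_sum forms_scale) auto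
      with s have "(\<Sum>v\<in>C. scale_poly (c' v) v) \<in> mpoly.span B"
        using BC(2) by (auto simp: eq)
      then obtain u where u: "(\<Sum>v\<in>C. scale_poly (c' v) v) = (\<Sum>v\<in>B. scale_poly (u v) v)"
        using span_finite_sum[OF BC(7)] by blast
      \<comment> \<open>One element is written both over \<open>C\<close> and over \<open>B\<close>.
        The difference of the two expressions is a linear relation on the basis
        \<open>B \<union> C\<close>.\<close>
      define w where "w v = (if v \<in> C then c' v else - u v)" for v
      have "(\<Sum>v\<in>B\<union>C. scale_poly (w v) v) =
          (\<Sum>v\<in>B. scale_poly (w v) v) + (\<Sum>v\<in>C. scale_poly (w v) v)"
        by (rule sum.union_disjoint) (use BC in auto)
      also have "(\<Sum>v\<in>B. scale_poly (w v) v) = (\<Sum>v\<in>B. - scale_poly (u v) v)"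
        by (rule sum.cong) (use BC(6) in \<open>auto simp: w_def\<close>)
      also have "(\<Sum>v\<in>C. scale_poly (w v) v) = (\<Sum>v\<in>C. scale_poly (c' v) v)"
        by (rule sum.cong) (auto simp: w_def)
      finally have "(\<Sum>v\<in>B\<union>C. scale_poly (w v) v) = 0"
        by (simp add: u sum_negf)
      then have "w (b j) = 0"
        using mpoly.independentD[OF BC(5), of "B \<union> C" w "b j"] BC bC j by auto
      then show "c j = 0" using bC j by (simp add: w_def c')
    qed
    show "spans_mod I b {..<hilbert_function I d} (forms d)"
      unfolding spans_mod_def
    proof
      fix \<Phi> :: "('v, 'k) mpoly" assume "\<Phi> \<in> forms d"
      then obtain u where u: "\<Phi> = (\<Sum>v\<in>B\<union>C. scale_poly (u v) v)"
        using span_finite_sum[of "B \<union> C" \<Phi>] BC by auto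
      have "\<Phi> = (\<Sum>v\<in>B. scale_poly (u v) v) + (\<Sum>v\<in>C. scale_poly (u v) v)"
        unfolding u by (rule sum.union_disjoint) (use BC in auto)
      also have "(\<Sum>v\<in>C. scale_poly (u v) v) =
          (\<Sum>j<hilbert_function I d. scale_poly (u (b j)) (b j))"
        unfolding im[symmetric] by (subst sum.reindex[OF inj]) auto
      finally have "\<Phi> - (\<Sum>j<hilbert_function I d. scale_poly (u (b j)) (b j)) =
          (\<Sum>v\<in>B. scale_poly (u v) v)" by (simp add: algebra_simps)
      moreover have "(\<Sum>v\<in>B. scale_poly (u v) v) \<in> I"
        using BC(1) by (intro self_module.subspace_sum[OF I] ideal_scale[OF I]) auto
      ultimately show "\<exists>c. \<Phi> - (\<Sum>j<hilbert_function I d. scale_poly (c j) (b j)) \<in> I"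
        by (intro exI[of _ "\<lambda>j. u (b j)"]) simp
    qed
  qed
qed

lemma indep_mod_inj_on:
  assumes I: "self_module.subspace I" and b: "indep_mod I b J" and "finite J"
  shows "inj_on b J"
proof (rule inj_onI, rule ccontr)
  fix i j assume ij: "i \<in> J" "j \<in> J" "b i = b j" "i \<noteq> j"
  define c where "c k = (if k = i then 1 else if k = j then - 1 else 0 :: 'b)" for k
  have "(\<Sum>k\<in>J. scale_poly (c k) (b k)) = (\<Sum>k\<in>{i, j}. scale_poly (c k) (b k))"
    by (rule sum.mono_neutral_right) (use ij \<open>finite J\<close> in \<open>auto simp: c_def\<close>)
  also have "\<dots> = 0" using ij by (simp add: c_def)
  finally have "c i = 0" using indep_modD[OF b, of c i] ij self_module.subspace_0[OF I] by simp
  then show False by (simp add: c_def)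
qed

text \<open>A basis of the degree d part of \<open>I\<close> stays independent when the family is
  adjoined, so the exchange bound against the adapted basis applies. All lower bounds on Hilbert
  functions go through this.\<close>

lemma card_le_hilbert_function:
  fixes I :: "('v::finite, 'k::field) mpoly set"
  assumes I: "self_module.subspace I" and fin: "finite J"
    and b: "indep_mod I b J" and bf: "\<And>j. j \<in> J \<Longrightarrow> b j \<in> forms d"
  shows "card J \<le> hilbert_function I d"
proof -
  obtain B C where BC: "B \<subseteq> I \<inter> forms d" "I \<inter> forms d \<subseteq> mpoly.span B"
    "forms d \<subseteq> mpoly.span (B \<union> C)" "mpoly.independent (B \<union> C)" "B \<inter> C = {}" "finite B" "finite C"
    "card C = hilbert_function I d"
    by (rule hilbert_function_adapted_basis[OF I, where d = d])
  have inj: "inj_on b J" by (rule indep_mod_inj_on[OF I b fin])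
  have B0: "u v = 0" if "(\<Sum>v\<in>B. scale_poly (u v) v) = 0" "v \<in> B" for u v
    using mpoly.independentD[OF BC(4) BC(6), of u v] that by auto
  have J0: "u j = 0"
    if "(\<Sum>v\<in>B. scale_poly (w v) v) + (\<Sum>j\<in>J. scale_poly (u j) (b j)) = 0" "j \<in> J" for u w j
  proof -
    have "(\<Sum>v\<in>B. scale_poly (w v) v) \<in> I"
      using BC(1) by (intro self_module.subspace_sum[OF I] ideal_scale[OF I]) auto
    then have "- (\<Sum>v\<in>B. scale_poly (w v) v) \<in> I" by (rule self_module.subspace_neg[OF I])
    moreover have "- (\<Sum>v\<in>B. scale_poly (w v) v) = (\<Sum>j\<in>J. scale_poly (u j) (b j))"
      using that(1) by (simp add: minus_unique)
    ultimately show ?thesis using indep_modD[OF b, of u j] that(2) by simp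
  qed
  have disj: "B \<inter> b ` J = {}"
  proof (rule ccontr)
    assume "B \<inter> b ` J \<noteq> {}"
    then obtain j where j: "j \<in> J" "b j \<in> B" by auto
    have "(\<Sum>i\<in>J. scale_poly (if i = j then 1 else 0) (b i)) = (\<Sum>i\<in>J. if i = j then b j else 0)"
      by (rule sum.cong) auto
    also have "\<dots> = b j" using j(1) fin by simp
    finally have "(\<Sum>i\<in>J. scale_poly (if i = j then 1 else 0) (b i)) \<in> I" using j BC(1) by auto
    from indep_modD[OF b this j(1)] show False by simp
  qed
  have indep: "mpoly.independent (B \<union> b ` J)"
  proof (rule mpoly.independent_if_scalars_zero)
    show "finite (B \<union> b ` J)" using BC fin by simp
    fix f x assume s: "(\<Sum>x\<in>B \<union> b ` J. scale_poly (f x) x) = 0" and x: "x \<in> B \<union> b ` J"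
    have "(\<Sum>x\<in>B \<union> b ` J. scale_poly (f x) x) =
        (\<Sum>x\<in>B. scale_poly (f x) x) + (\<Sum>x\<in>b ` J. scale_poly (f x) x)"
      by (rule sum.union_disjoint) (use BC fin disj in auto)
    also have "(\<Sum>x\<in>b ` J. scale_poly (f x) x) = (\<Sum>j\<in>J. scale_poly (f (b j)) (b j))"
      by (subst sum.reindex[OF inj]) auto
    finally have s': "(\<Sum>x\<in>B. scale_poly (f x) x) + (\<Sum>j\<in>J. scale_poly (f (b j)) (b j)) = 0"
      using s by simp
    have fJ: "f (b j) = 0" if "j \<in> J" for j by (rule J0[OF s' that])
    with s' have "(\<Sum>x\<in>B. scale_poly (f x) x) = 0" by simp
    with B0 fJ x show "f x = 0" by auto
  qed
  have "B \<union> b ` J \<subseteq> mpoly.span (B \<union> C)" using BC(1,3) bf by blast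
  with indep BC have "card (B \<union> b ` J) \<le> card (B \<union> C)"
    using mpoly.independent_span_bound[of "B \<union> C" "B \<union> b ` J"] by auto
  moreover have "card (B \<union> b ` J) = card B + card J"
    using disj fin BC inj by (simp add: card_Un_disjoint card_image)
  moreover have "card (B \<union> C) = card B + hilbert_function I d"
    using BC by (simp add: card_Un_disjoint)
  ultimately show ?thesis by simp
qed

text \<open>Together with a basis of the degree d part of \<open>I\<close>, the family spans all
  forms of degree d.\<close>

lemma hilbert_function_le_card:
  fixes I :: "('v::finite, 'k::field) mpoly set"
  assumes I: "self_module.subspace I" and fin: "finite J" and b: "spans_mod I b J (forms d)"
    and bf: "\<And>j. j \<in> J \<Longrightarrow> b j \<in> forms d"
  shows "hilbert_function I d \<le> card J"
proof -
  obtain B C where BC: "I \<inter> forms d \<subseteq> mpoly.span B" "B \<inter> C = {}" "finite B"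
    "card C = hilbert_function I d" "card B + card C = mpoly.dim (forms d :: ('v, 'k) mpoly set)"
    by (rule hilbert_function_adapted_basis[OF I, where d = d])
  have "forms d \<subseteq> mpoly.span (B \<union> b ` J)"
  proof
    fix \<Phi> :: "('v, 'k) mpoly" assume \<Phi>: "\<Phi> \<in> forms d"
    then obtain c where c: "\<Phi> - (\<Sum>j\<in>J. scale_poly (c j) (b j)) \<in> I"
      using b by (auto simp: spans_mod_def)
    have "\<Phi> - (\<Sum>j\<in>J. scale_poly (c j) (b j)) \<in> forms d"
      by (intro mpoly.subspace_diff[OF subspace_forms] \<Phi> forms_sum forms_scale bf)
    with c BC(1) have "\<Phi> - (\<Sum>j\<in>J. scale_poly (c j) (b j)) \<in> mpoly.span (B \<union> b ` J)"
      using mpoly.span_mono[of B "B \<union> b ` J"] by auto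
    moreover have "(\<Sum>j\<in>J. scale_poly (c j) (b j)) \<in> mpoly.span (B \<union> b ` J)"
      by (intro mpoly.span_sum mpoly.span_scale mpoly.span_base) auto
    ultimately have "(\<Phi> - (\<Sum>j\<in>J. scale_poly (c j) (b j))) + (\<Sum>j\<in>J. scale_poly (c j) (b j)) \<in>
        mpoly.span (B \<union> b ` J)" by (rule mpoly.span_add)
    then show "\<Phi> \<in> mpoly.span (B \<union> b ` J)" by simp
  qed
  then have "mpoly.dim (forms d :: ('v, 'k) mpoly set) \<le> card (B \<union> b ` J)"
    using BC(3) fin by (intro mpoly.dim_le_card) auto
  also have "\<dots> \<le> card B + card J"
    using card_Un_le[of B "b ` J"] card_image_le[OF fin, of b] by linarith
  finally show ?thesis using BC(4,5) by linarith
qed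

lemma scheme_degree_eqI:
  assumes "eventually (\<lambda>d. hilbert_function I d = s) sequentially"
  shows "scheme_degree I = s"
  unfolding scheme_degree_def
proof (rule the_equality)
  fix s' assume "eventually (\<lambda>d. hilbert_function I d = s') sequentially"
  with assms have "eventually (\<lambda>d. s' = s) sequentially" by eventually_elim simp
  then show "s' = s" by simp
qed fact

lemma eventually_scheme_degree:
  "zero_dim_subscheme I \<Longrightarrow> eventually (\<lambda>d. hilbert_function I d = scheme_degree I) sequentially"
  using scheme_degree_eqI unfolding zero_dim_subscheme_def by metis

lemma proj_subscheme_subspace: "proj_subscheme I \<Longrightarrow> self_module.subspace I"
  by (simp add: proj_subscheme_def)

lemma saturationD:
  assumes "proj_subscheme I" "\<And>\<Psi>. \<Psi> \<in> forms m \<Longrightarrow> \<Psi> * \<Phi> \<in> I"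
  shows "\<Phi> \<in> I"
  using assms unfolding proj_subscheme_def saturation_def by blast

lemma proj_subschemeI:
  assumes "self_module.subspace I" "\<And>\<Phi> d. \<Phi> \<in> I \<Longrightarrow> hom_component d \<Phi> \<in> I"
    and "\<And>\<Phi> m. (\<And>\<Psi>. \<Psi> \<in> forms m \<Longrightarrow> \<Psi> * \<Phi> \<in> I) \<Longrightarrow> \<Phi> \<in> I"
  shows "proj_subscheme I"
proof -
  have "saturation I = I"
  proof
    show "I \<subseteq> saturation I"
      using self_module.subspace_scale[OF assms(1)] by (auto simp: saturation_def)
    show "saturation I \<subseteq> I"
      using assms(3) by (auto simp: saturation_def)
  qed
  with assms(1,2) show ?thesis by (simp add: proj_subscheme_def)
qed


section \<open>Extension of the ground field\<close>

lemma map_single_zero [simp]: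
  "f 0 = 0 \<Longrightarrow> Poly_Mapping.map f (Poly_Mapping.single \<alpha> c) = Poly_Mapping.single \<alpha> (f c)"
  by (rule poly_mapping_eqI) (simp add: lookup_map_zero lookup_single when_def)

lemma map_zero_zero [simp]: "f 0 = 0 \<Longrightarrow> Poly_Mapping.map f 0 = 0"
  by (rule poly_mapping_eqI) (simp add: lookup_map_zero)

lemma map_additive:
  assumes "f 0 = 0" "\<And>x y. f (x + y) = f x + f y"
  shows "Poly_Mapping.map f (\<Phi> + \<Psi>) = Poly_Mapping.map f \<Phi> + Poly_Mapping.map f \<Psi>"
  by (rule poly_mapping_eqI) (simp add: lookup_map_zero assms lookup_add)

lemma map_hom_component:
  "f 0 = 0 \<Longrightarrow> Poly_Mapping.map f (hom_component d \<Phi>) = hom_component d (Poly_Mapping.map f \<Phi>)"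
  by (rule poly_mapping_eqI) (simp add: lookup_map_zero lookup_hom_component)

lemma map_mem_forms: "f 0 = 0 \<Longrightarrow> \<Phi> \<in> forms d \<Longrightarrow> Poly_Mapping.map f \<Phi> \<in> forms d"
  by (simp add: mem_forms_iff lookup_map_zero)

locale field_embedding =
  fixes h :: "'k::field \<Rightarrow> 'l::field"
  assumes add: "h (x + y) = h x + h y"
    and mult: "h (x * y) = h x * h y"
    and one [simp]: "h 1 = 1"
begin

lemma zero [simp]: "h 0 = 0"
  using add[of 0 0] by (metis add_cancel_right_right add_0)

lemma eq_0_iff [simp]: "h x = 0 \<longleftrightarrow> x = 0"
proof
  assume "h x = 0"
  then have "h (x * inverse x) = 0" by (simp add: mult)
  then show "x = 0" by (rule contrapos_pp) simp
qed simp

lemma power: "h (x ^ n) = h x ^ n"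
  by (induction n) (auto simp: mult)

lemma prod: "h (\<Prod>i\<in>A. f i) = (\<Prod>i\<in>A. h (f i))"
  by (induction A rule: infinite_finite_induct) (auto simp: mult)

lemma sum: "h (\<Sum>i\<in>A. f i) = (\<Sum>i\<in>A. h (f i))"
  by (induction A rule: infinite_finite_induct) (auto simp: add)

lemma map_mult:
  "Poly_Mapping.map h (\<Phi> * \<Psi>) = Poly_Mapping.map h \<Phi> * Poly_Mapping.map h \<Psi>"
proof (induction \<Phi> rule: poly_mapping_single_add_induct)
  case (single \<alpha> c)
  show ?case
    by (induction \<Psi> rule: poly_mapping_single_add_induct)
      (simp_all add: mult_single mult map_additive add distrib_left)
qed (simp add: map_additive add distrib_right)

text \<open>These are the linear forms on the large field as a vector space over the small one.
  Applied to each coefficient, they turn polynomials over the large field into polynomials over the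
  small one.\<close>

definition functional :: "('l \<Rightarrow> 'k) \<Rightarrow> bool" where
  "functional f \<longleftrightarrow> (\<forall>x y. f (x + y) = f x + f y) \<and> (\<forall>c x. f (h c * x) = c * f x)"

lemma functional_add: "functional f \<Longrightarrow> f (x + y) = f x + f y"
  and functional_scale: "functional f \<Longrightarrow> f (h c * x) = c * f x"
  by (simp_all add: functional_def)

lemma functional_scale_right: "functional f \<Longrightarrow> f (x * h c) = f x * c"
  using functional_scale[of f c x] by (simp add: mult.commute)

lemma functional_zero: "functional f \<Longrightarrow> f 0 = 0"
  using functional_scale[of f 0 0] by simp

lemma functional_sum: "functional f \<Longrightarrow> f (\<Sum>i\<in>A. g i) = (\<Sum>i\<in>A. f (g i))"
  by (induction A rule: infinite_finite_induct) (simp_all add: functional_zero functional_add)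

lemma functional_mult: "functional f \<Longrightarrow> functional (\<lambda>x. f (a * x))"
  unfolding functional_def by (metis distrib_left mult.left_commute)

text \<open>A basis of the field extension may be infinite, but finitely many elements involve only
  finitely many of its members.\<close>

lemma functional_coordinates:
  assumes "finite Y"
  obtains B cf where "finite B" "\<And>b. functional (cf b)"
    "\<And>x. x \<in> Y \<Longrightarrow> x = (\<Sum>b\<in>B. h (cf b x) * b)"
proof -
  interpret L: vector_space "\<lambda>c x. h c * x"
    by unfold_locales (simp_all add: algebra_simps add mult)
  obtain E where E: "L.independent E" "UNIV \<subseteq> L.span E"
    using L.maximal_independent_subset[of UNIV] by auto
  define B where "B = (\<Union>x\<in>Y. {b. L.representation E x b \<noteq> 0})"
  have span: "x \<in> L.span E" for x using E(2) by blast
  have fin: "finite B" using assms by (auto simp: B_def L.finite_representation)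
  show ?thesis
  proof (rule that[of B "\<lambda>b x. L.representation E x b"])
    show "functional (\<lambda>x. L.representation E x b)" for b
      by (simp add: functional_def L.representation_add[OF E(1) span span]
          L.representation_scale[OF E(1) span])
    show "x = (\<Sum>b\<in>B. h (L.representation E x b) * b)" if "x \<in> Y" for x
    proof -
      have "x = (\<Sum>b | L.representation E x b \<noteq> 0. h (L.representation E x b) * b)"
        using L.sum_nonzero_representation_eq[OF E(1) span] by simp
      also have "\<dots> = (\<Sum>b\<in>B. h (L.representation E x b) * b)"
        by (rule sum.mono_neutral_left) (use fin that in \<open>auto simp: B_def\<close>)
      finally show ?thesis .
    qed
  qed fact
qed

lemma functional_separates:
  assumes "\<And>f. functional f \<Longrightarrow> f x = 0"
  shows "x = 0"
proof -
  have "finite {x}" by simp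
  then obtain B cf where B: "\<And>b. functional (cf b)" "\<And>y. y \<in> {x} \<Longrightarrow> y = (\<Sum>b\<in>B. h (cf b y) * b)"
    using functional_coordinates[of "{x}" thesis] by blast
  have "x = (\<Sum>b\<in>B. h (cf b x) * b)" by (rule B(2)) simp
  also have "\<dots> = 0" using assms[OF B(1)] by simp
  finally show ?thesis .
qed

text \<open>A functional is linear over the small field only, so it commutes with exactly the kind
  of factor whose coefficients come from there.\<close>

lemma map_functional_mult:
  assumes f: "functional f"
  shows "Poly_Mapping.map f (Poly_Mapping.map h \<phi> * \<Phi>) = \<phi> * Poly_Mapping.map f \<Phi>"
proof (induction \<phi> rule: poly_mapping_single_add_induct)
  case (single \<alpha> c)
  show ?case
    by (induction \<Phi> rule: poly_mapping_single_add_induct)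
      (simp_all add: mult_single functional_zero[OF f] functional_scale[OF f] map_additive
        functional_add[OF f] distrib_left)
qed (simp add: map_additive add distrib_right functional_zero[OF f] functional_add[OF f])

lemma coordinates_poly_mapping:
  fixes \<Phi> :: "('v, 'l) mpoly"
  obtains B cf where "finite B" "\<And>b. functional (cf b)"
    "\<Phi> = (\<Sum>b\<in>B. scale_poly b (Poly_Mapping.map h (Poly_Mapping.map (cf b) \<Phi>)))"
proof -
  obtain B cf where B: "finite B" "\<And>b. functional (cf b)"
    "\<And>x. x \<in> Poly_Mapping.lookup \<Phi> ` Poly_Mapping.keys \<Phi> \<Longrightarrow> x = (\<Sum>b\<in>B. h (cf b x) * b)"
    using functional_coordinates[of "Poly_Mapping.lookup \<Phi> ` Poly_Mapping.keys \<Phi>"] by auto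
  have "\<Phi> = (\<Sum>b\<in>B. scale_poly b (Poly_Mapping.map h (Poly_Mapping.map (cf b) \<Phi>)))"
  proof (rule poly_mapping_eqI)
    fix \<alpha>
    have "Poly_Mapping.lookup (\<Sum>b\<in>B. scale_poly b (Poly_Mapping.map h (Poly_Mapping.map (cf b) \<Phi>))) \<alpha> =
        (\<Sum>b\<in>B. h (cf b (Poly_Mapping.lookup \<Phi> \<alpha>)) * b)"
      by (simp add: lookup_sum lookup_map_zero functional_zero B(2) mult.commute)
    also have "\<dots> = Poly_Mapping.lookup \<Phi> \<alpha>"
    proof (cases "\<alpha> \<in> Poly_Mapping.keys \<Phi>")
      case True
      then show ?thesis using B(3)[of "Poly_Mapping.lookup \<Phi> \<alpha>"] by simp
    next
      case False
      then show ?thesis by (simp add: in_keys_iff functional_zero B(2))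
    qed
    finally show "Poly_Mapping.lookup \<Phi> \<alpha> = Poly_Mapping.lookup
        (\<Sum>b\<in>B. scale_poly b (Poly_Mapping.map h (Poly_Mapping.map (cf b) \<Phi>))) \<alpha>" ..
  qed
  with B that show ?thesis by blast
qed

end

section \<open>Extended ideals: membership, saturation, Hilbert function, points\<close>

definition base_change :: "('k \<Rightarrow> 'l) \<Rightarrow> ('v, 'k::field) mpoly set \<Rightarrow> ('v, 'l::field) mpoly set" where
  "base_change h I = self_module.span (Poly_Mapping.map h ` I)"

lemma geometric_ideal_base_change: "geometric_ideal I = base_change to_ac I"
  by (simp add: geometric_ideal_def base_change_def)

lemma base_change_subspace: "self_module.subspace (base_change h I)"
  unfolding base_change_def by (rule self_module.subspace_span)

context field_embedding
begin

lemma mem_base_change: "\<phi> \<in> I \<Longrightarrow> Poly_Mapping.map h \<phi> \<in> base_change h I"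
  unfolding base_change_def by (intro self_module.span_base imageI)

text \<open>The right-hand side defines an ideal that contains the generators: a factor c from the
  large field is absorbed by replacing f with x \<mapsto> f(c x), again a functional. Conversely,
  expanding the coefficients in a basis of the extension writes \<Phi> as a combination of images of
  members of \<open>I\<close>.\<close>

lemma mem_base_change_iff:
  fixes I :: "('v, 'k) mpoly set"
  assumes I: "self_module.subspace I"
  shows "\<Phi> \<in> base_change h I \<longleftrightarrow> (\<forall>f. functional f \<longrightarrow> Poly_Mapping.map f \<Phi> \<in> I)"
proof
  let ?J = "{\<Phi>. \<forall>f. functional f \<longrightarrow> Poly_Mapping.map f \<Phi> \<in> I}"
  have "base_change h I \<subseteq> ?J"
    unfolding base_change_def
  proof (rule self_module.span_minimal)
    show "Poly_Mapping.map h ` I \<subseteq> ?J"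
    proof clarify
      fix \<phi> f assume "\<phi> \<in> I" and f: "functional f"
      have "Poly_Mapping.map f (Poly_Mapping.map h \<phi> * 1) = \<phi> * Poly_Mapping.map f 1"
        by (rule map_functional_mult[OF f])
      also have "\<dots> \<in> I"
        by (subst mult.commute) (rule self_module.subspace_scale[OF I \<open>\<phi> \<in> I\<close>])
      finally show "Poly_Mapping.map f (Poly_Mapping.map h \<phi>) \<in> I" by simp
    qed
    show "self_module.subspace ?J"
    proof (rule self_module_subspaceI)
      show "0 \<in> ?J" using self_module.subspace_0[OF I] by (simp add: functional_zero)
      show "\<Phi> + \<Psi> \<in> ?J" if "\<Phi> \<in> ?J" "\<Psi> \<in> ?J" for \<Phi> \<Psi>
        using that self_module.subspace_add[OF I]
        by (simp add: map_additive functional_zero functional_add)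
      show "Poly_Mapping.single \<alpha> c * \<Phi> \<in> ?J" if \<Phi>: "\<Phi> \<in> ?J" for \<alpha> c \<Phi>
      proof clarify
        fix f assume f: "functional f"
        let ?g = "\<lambda>x. f (c * x)"
        have g: "functional ?g" using f by (rule functional_mult)
        have "Poly_Mapping.map f (Poly_Mapping.single \<alpha> c * \<Phi>) =
            Poly_Mapping.map ?g (Poly_Mapping.map h (mon \<alpha>) * \<Phi>)"
          by (induction \<Phi> rule: poly_mapping_single_add_induct)
            (simp_all add: mult_single functional_zero[OF f] map_additive functional_add[OF f]
              distrib_left)
        also have "\<dots> = mon \<alpha> * Poly_Mapping.map ?g \<Phi>" by (rule map_functional_mult[OF g])
        also have "\<dots> \<in> I" using \<Phi> g by (intro self_module.subspace_scale[OF I]) auto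
        finally show "Poly_Mapping.map f (Poly_Mapping.single \<alpha> c * \<Phi>) \<in> I" .
      qed
    qed
  qed
  then show "\<Phi> \<in> base_change h I \<Longrightarrow> \<forall>f. functional f \<longrightarrow> Poly_Mapping.map f \<Phi> \<in> I" by auto
next
  assume R: "\<forall>f. functional f \<longrightarrow> Poly_Mapping.map f \<Phi> \<in> I"
  obtain B cf where B: "\<And>b. functional (cf b)"
    "\<Phi> = (\<Sum>b\<in>B. scale_poly b (Poly_Mapping.map h (Poly_Mapping.map (cf b) \<Phi>)))"
    using coordinates_poly_mapping[of \<Phi> thesis] by blast
  have "(\<Sum>b\<in>B. scale_poly b (Poly_Mapping.map h (Poly_Mapping.map (cf b) \<Phi>))) \<in> base_change h I"
    using R B(1)
    by (intro self_module.subspace_sum[OF base_change_subspace] ideal_scale[OF base_change_subspace]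
        mem_base_change) auto
  with B(2) show "\<Phi> \<in> base_change h I" by simp
qed

text \<open>For saturation it suffices to multiply by forms over the small field: they are among the
  forms that test saturation over the large one, and functionals commute with them.\<close>

lemma proj_subscheme_base_change:
  fixes I :: "('v::finite, 'k) mpoly set"
  assumes I: "proj_subscheme I"
  shows "proj_subscheme (base_change h I)"
proof (rule proj_subschemeI)
  note sub = proj_subscheme_subspace[OF I]
  show "self_module.subspace (base_change h I)" by (rule base_change_subspace)
  show "hom_component d \<Phi> \<in> base_change h I" if "\<Phi> \<in> base_change h I" for \<Phi> d
    using that I unfolding mem_base_change_iff[OF sub]
    by (simp add: map_hom_component functional_zero proj_subscheme_def)
  show "\<Phi> \<in> base_change h I" if \<Phi>: "\<And>\<Psi>. \<Psi> \<in> forms m \<Longrightarrow> \<Psi> * \<Phi> \<in> base_change h I" for \<Phi> m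
    unfolding mem_base_change_iff[OF sub]
  proof (intro allI impI)
    fix f assume f: "functional f"
    show "Poly_Mapping.map f \<Phi> \<in> I"
    proof (rule saturationD[OF I, of m])
      fix \<Psi> :: "('v, 'k) mpoly" assume "\<Psi> \<in> forms m"
      then have "Poly_Mapping.map h \<Psi> * \<Phi> \<in> base_change h I"
        by (intro \<Phi> map_mem_forms) simp_all
      then show "\<Psi> * Poly_Mapping.map f \<Phi> \<in> I"
        using f by (auto simp: mem_base_change_iff[OF sub] map_functional_mult)
    qed
  qed
qed

text \<open>A basis of the quotient in degree d remains one. Functionals turn a relation over the
  large field into relations over the small one, and spanning follows by expanding the coefficients
  in a basis of the extension.\<close>

lemma hilbert_function_base_change:
  fixes I :: "('v::finite, 'k) mpoly set"
  assumes I: "self_module.subspace I"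
  shows "hilbert_function (base_change h I) d = hilbert_function I d"
proof -
  define s where "s = hilbert_function I d"
  obtain b where b: "\<And>j. j < s \<Longrightarrow> b j \<in> forms d" "indep_mod I b {..<s}"
    "spans_mod I b {..<s} (forms d)"
    unfolding s_def using hilbert_function_basis[OF I, of d thesis] by blast
  let ?b = "\<lambda>j. Poly_Mapping.map h (b j)"
  have bf: "?b j \<in> forms d" if "j \<in> {..<s}" for j
    using that b(1) by (intro map_mem_forms) auto
  have "indep_mod (base_change h I) ?b {..<s}"
    unfolding indep_mod_def
  proof (intro allI impI ballI)
    fix c j assume c: "(\<Sum>j<s. scale_poly (c j) (?b j)) \<in> base_change h I" and j: "j \<in> {..<s}"
    show "c j = 0"
    proof (rule functional_separates)
      fix f assume f: "functional f"
      have "Poly_Mapping.map f (\<Sum>j<s. scale_poly (c j) (?b j)) = (\<Sum>j<s. scale_poly (f (c j)) (b j))"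
        by (rule poly_mapping_eqI)
          (simp add: lookup_map_zero functional_zero[OF f] lookup_sum functional_sum[OF f]
            functional_scale_right[OF f])
      then have "(\<Sum>j<s. scale_poly (f (c j)) (b j)) \<in> I"
        using c f by (auto simp: mem_base_change_iff[OF I])
      from indep_modD[OF b(2) this j] show "f (c j) = 0" .
    qed
  qed
  then have "card {..<s} \<le> hilbert_function (base_change h I) d"
    using bf by (intro card_le_hilbert_function[OF base_change_subspace]) simp_all
  moreover have "spans_mod (base_change h I) ?b {..<s} (forms d)"
    unfolding spans_mod_def
  proof
    fix \<Phi> :: "('v, 'l) mpoly" assume \<Phi>: "\<Phi> \<in> forms d"
    obtain B cf where B: "finite B" "\<And>b. functional (cf b)"
      "\<Phi> = (\<Sum>b\<in>B. scale_poly b (Poly_Mapping.map h (Poly_Mapping.map (cf b) \<Phi>)))"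
      using coordinates_poly_mapping[of \<Phi> thesis] by blast
    have "\<exists>c. Poly_Mapping.map (cf e) \<Phi> - (\<Sum>j<s. scale_poly (c j) (b j)) \<in> I" for e
      using b(3) \<Phi> B(2) unfolding spans_mod_def by (simp add: map_mem_forms functional_zero)
    then obtain c where c: "\<And>e. Poly_Mapping.map (cf e) \<Phi> - (\<Sum>j<s. scale_poly (c e j) (b j)) \<in> I"
      by metis
    let ?r = "\<lambda>e. Poly_Mapping.map (cf e) \<Phi> - (\<Sum>j<s. scale_poly (c e j) (b j))"
    have minus: "h (x - y) = h x - h y" for x y
      using add[of "x - y" y] by simp
    have "\<Phi> - (\<Sum>j<s. scale_poly (\<Sum>e\<in>B. e * h (c e j)) (?b j)) =
        (\<Sum>e\<in>B. scale_poly e (Poly_Mapping.map h (?r e)))" (is "?L = ?R")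
    proof (rule poly_mapping_eqI)
      fix \<alpha>
      have "Poly_Mapping.lookup ?L \<alpha> = Poly_Mapping.lookup \<Phi> \<alpha> -
          (\<Sum>j<s. \<Sum>e\<in>B. e * (h (c e j) * h (Poly_Mapping.lookup (b j) \<alpha>)))"
        by (simp add: lookup_minus lookup_sum lookup_map_zero sum_distrib_right mult.assoc)
      also have "Poly_Mapping.lookup \<Phi> \<alpha> = (\<Sum>e\<in>B. e * h (cf e (Poly_Mapping.lookup \<Phi> \<alpha>)))"
        by (subst B(3)) (simp add: lookup_sum lookup_map_zero functional_zero B(2))
      also have "(\<Sum>j<s. \<Sum>e\<in>B. e * (h (c e j) * h (Poly_Mapping.lookup (b j) \<alpha>))) =
          (\<Sum>e\<in>B. e * (\<Sum>j<s. h (c e j) * h (Poly_Mapping.lookup (b j) \<alpha>)))"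
        by (subst sum.swap) (simp add: sum_distrib_left)
      also have "(\<Sum>e\<in>B. e * h (cf e (Poly_Mapping.lookup \<Phi> \<alpha>))) - \<dots> = Poly_Mapping.lookup ?R \<alpha>"
        by (simp add: lookup_sum lookup_map_zero functional_zero B(2) lookup_minus minus
            sum mult sum_subtractf right_diff_distrib)
      finally show "Poly_Mapping.lookup ?L \<alpha> = Poly_Mapping.lookup ?R \<alpha>" .
    qed
    also have "?R \<in> base_change h I"
      using c by (intro self_module.subspace_sum[OF base_change_subspace]
          ideal_scale[OF base_change_subspace] mem_base_change)
    finally show "\<exists>c. \<Phi> - (\<Sum>j<s. scale_poly (c j) (?b j)) \<in> base_change h I"
      by (intro exI[of _ "\<lambda>j. \<Sum>e\<in>B. e * h (c e j)"])
  qed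
  then have "hilbert_function (base_change h I) d \<le> card {..<s}"
    using bf by (intro hilbert_function_le_card[OF base_change_subspace]) simp_all
  ultimately show ?thesis by (simp add: s_def)
qed

lemma zero_dim_subscheme_base_change:
  "zero_dim_subscheme I \<Longrightarrow> zero_dim_subscheme (base_change h I)"
  by (simp add: zero_dim_subscheme_def proj_subscheme_base_change hilbert_function_base_change
      proj_subscheme_subspace)

lemma scheme_degree_base_change:
  "self_module.subspace I \<Longrightarrow> scheme_degree (base_change h I) = scheme_degree I"
  by (simp add: scheme_degree_def hilbert_function_base_change)

lemma mon_eval_embedding: "mon_eval (\<lambda>v. h (p v)) \<alpha> = h (mon_eval p \<alpha>)"
  by (simp add: mon_eval_def prod power)

lemma coeff_line_eval_functional:
  assumes f: "functional f"
  shows "coeff (line_eval p (Poly_Mapping.map f \<Phi>)) d = f (coeff (line_eval (\<lambda>v. h (p v)) \<Phi>) d)"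
proof (induction \<Phi> rule: poly_mapping_single_add_induct)
  case (single \<alpha> c)
  show ?case by (simp add: functional_zero[OF f] mon_eval_embedding functional_scale_right[OF f])
qed (simp add: map_additive functional_zero[OF f] functional_add[OF f] line_eval_add)

text \<open>Vanishing at a point with coordinates in the small field is a linear condition with
  coefficients there, so it can be tested after applying all functionals. The extended ideal is
  again given by points and therefore radical, which needs no separability.\<close>

lemma base_change_cone_ideal:
  "base_change h (cone_ideal V) = cone_ideal ((\<lambda>p v. h (p v)) ` V)"
proof -
  have *: "Poly_Mapping.map f \<Phi> \<in> cone_ideal V \<longleftrightarrow>
      (\<forall>p\<in>V. \<forall>d. f (coeff (line_eval (\<lambda>v. h (p v)) \<Phi>) d) = 0)" if "functional f" for f \<Phi>
    using that by (simp add: cone_ideal_def poly_eq_iff coeff_line_eval_functional)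
  have "\<Phi> \<in> base_change h (cone_ideal V) \<longleftrightarrow> \<Phi> \<in> cone_ideal ((\<lambda>p v. h (p v)) ` V)" for \<Phi>
  proof -
    have "\<Phi> \<in> base_change h (cone_ideal V) \<longleftrightarrow>
        (\<forall>p\<in>V. \<forall>d. \<forall>f. functional f \<longrightarrow> f (coeff (line_eval (\<lambda>v. h (p v)) \<Phi>) d) = 0)"
      unfolding mem_base_change_iff[OF cone_ideal_subspace] using * by blast
    also have "\<dots> \<longleftrightarrow> (\<forall>p\<in>V. \<forall>d. coeff (line_eval (\<lambda>v. h (p v)) \<Phi>) d = 0)"
      using functional_separates functional_zero by metis
    also have "\<dots> \<longleftrightarrow> \<Phi> \<in> cone_ideal ((\<lambda>p v. h (p v)) ` V)"
      by (simp add: cone_ideal_def poly_eq_iff)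
    finally show ?thesis .
  qed
  then show ?thesis by blast
qed

end

lemma field_embedding_to_ac: "field_embedding to_ac"
  by unfold_locales simp_all

lemma field_embedding_fls_const: "field_embedding fls_const"
  by unfold_locales (simp_all add: fls_plus_const)

text \<open>The constant term is a linear functional on the Laurent series.\<close>

lemma limit_ideal_base_change:
  fixes I :: "('v::finite, 'k::field) mpoly set"
  assumes I: "proj_subscheme I"
  shows "limit_ideal (base_change fls_const I) = I"
proof -
  interpret field_embedding "fls_const :: 'k \<Rightarrow> 'k fls" by (rule field_embedding_fls_const)
  note sub = proj_subscheme_subspace[OF I]
  have f: "functional (\<lambda>x :: 'k fls. fls_nth x 0)"
    by (simp add: functional_def)
  have "{Poly_Mapping.map (\<lambda>f. fps_nth f 0) \<Phi> | \<Phi> :: ('v, 'k fps) mpoly.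
      Poly_Mapping.map fps_to_fls \<Phi> \<in> base_change fls_const I} = I"
  proof (intro equalityI subsetI)
    fix \<phi> assume "\<phi> \<in> {Poly_Mapping.map (\<lambda>f. fps_nth f 0) \<Phi> | \<Phi> :: ('v, 'k fps) mpoly.
      Poly_Mapping.map fps_to_fls \<Phi> \<in> base_change fls_const I}"
    then obtain \<Phi> :: "('v, 'k fps) mpoly" where \<Phi>: "\<phi> = Poly_Mapping.map (\<lambda>f. fps_nth f 0) \<Phi>"
      "Poly_Mapping.map fps_to_fls \<Phi> \<in> base_change fls_const I" by blast
    have "\<phi> = Poly_Mapping.map (\<lambda>x. fls_nth x 0) (Poly_Mapping.map fps_to_fls \<Phi>)"
      unfolding \<Phi>(1) by (rule poly_mapping_eqI) (simp add: lookup_map_zero)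
    with \<Phi>(2) f show "\<phi> \<in> I" by (simp add: mem_base_change_iff[OF sub])
  next
    fix \<phi> assume "\<phi> \<in> I"
    then have "Poly_Mapping.map fls_const \<phi> \<in> base_change fls_const I" by (rule mem_base_change)
    moreover have "Poly_Mapping.map fps_to_fls (Poly_Mapping.map fps_const \<phi>) = Poly_Mapping.map fls_const \<phi>"
      by (rule poly_mapping_eqI) (simp add: lookup_map_zero)
    moreover have "\<phi> = Poly_Mapping.map (\<lambda>f. fps_nth f 0) (Poly_Mapping.map fps_const \<phi>)"
      by (rule poly_mapping_eqI) (simp add: lookup_map_zero)
    ultimately show "\<phi> \<in> {Poly_Mapping.map (\<lambda>f. fps_nth f 0) \<Phi> | \<Phi> :: ('v, 'k fps) mpoly.
      Poly_Mapping.map fps_to_fls \<Phi> \<in> base_change fls_const I}" by auto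
  qed
  then show ?thesis using I by (simp add: limit_ideal_def proj_subscheme_def)
qed


section \<open>Points over an algebraically closed field\<close>

text \<open>An ideal maximal among those that contain \<open>I\<close> and miss all powers of h is
  prime: adjoining any further element brings in some power of h.\<close>

lemma exists_prime_ideal_avoiding:
  fixes I :: "'r::comm_ring_1 set"
  assumes I: "self_module.subspace I" and h: "\<And>n. h ^ n \<notin> I"
  obtains P where "self_module.subspace P" "I \<subseteq> P" "h \<notin> P" "1 \<notin> P"
    "\<And>x y. x * y \<in> P \<Longrightarrow> x \<in> P \<or> y \<in> P"
proof -
  let ?A = "{J. self_module.subspace J \<and> I \<subseteq> J \<and> (\<forall>n. h ^ n \<notin> J)}"
  have "\<exists>M\<in>?A. \<forall>J\<in>?A. M \<subseteq> J \<longrightarrow> J = M"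
  proof (rule subset_Zorn_nonempty)
    show "?A \<noteq> {}" using I h by blast
    fix \<C> assume ne: "\<C> \<noteq> {}" and chain: "subset.chain ?A \<C>"
    have mem: "self_module.subspace J" "I \<subseteq> J" "h ^ n \<notin> J" if "J \<in> \<C>" for J n
      using chain that by (auto simp: subset.chain_def)
    have "self_module.subspace (\<Union>\<C>)"
      unfolding self_module.subspace_def
    proof (intro conjI ballI allI)
      show "0 \<in> \<Union>\<C>" using ne mem(1) self_module.subspace_0 by blast
      fix x assume x: "x \<in> \<Union>\<C>"
      then show "c * x \<in> \<Union>\<C>" for c using mem(1) self_module.subspace_scale by blast
      fix y assume "y \<in> \<Union>\<C>"
      with x obtain J K where JK: "J \<in> \<C>" "x \<in> J" "K \<in> \<C>" "y \<in> K" by blast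
      then have "J \<subseteq> K \<or> K \<subseteq> J" using chain by (auto simp: subset.chain_def)
      then show "x + y \<in> \<Union>\<C>" using JK mem(1) self_module.subspace_add by blast
    qed
    then show "\<Union>\<C> \<in> ?A" using ne mem by blast
  qed
  then obtain P where PA: "P \<in> ?A" and PM: "\<forall>J\<in>?A. P \<subseteq> J \<longrightarrow> J = P" ..
  have P: "self_module.subspace P" "I \<subseteq> P" "\<And>n. h ^ n \<notin> P" using PA by simp_all
  have max: "J = P" if "self_module.subspace J" "I \<subseteq> J" "\<And>n. h ^ n \<notin> J" "P \<subseteq> J" for J
    using PM that by simp
  have spanP: "self_module.span P = P" using P(1) by (simp add: self_module.span_eq_iff)
  have power_mem: "\<exists>n k. h ^ n - k * x \<in> P" if "x \<notin> P" for x
  proof (rule ccontr)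
    assume "\<not> (\<exists>n k. h ^ n - k * x \<in> P)"
    then have "h ^ n \<notin> self_module.span (insert x P)" for n
      by (simp add: self_module.span_breakdown_eq spanP)
    moreover have ins: "insert x P \<subseteq> self_module.span (insert x P)" by (rule self_module.span_superset)
    ultimately have "self_module.span (insert x P) = P"
      using P(2) by (intro max self_module.subspace_span) auto
    with that ins show False by simp
  qed
  show ?thesis
  proof (rule that[of P])
    show "x \<in> P \<or> y \<in> P" if xy: "x * y \<in> P" for x y
    proof (rule ccontr)
      assume "\<not> (x \<in> P \<or> y \<in> P)"
      then obtain m k n l where kl: "h ^ m - k * x \<in> P" "h ^ n - l * y \<in> P"
        using power_mem by meson
      \<comment> \<open>The multiples of x and of x y cancel and leave only a power of h.\<close>
      have "h ^ n * (h ^ m - k * x) + k * x * (h ^ n - l * y) + (k * l) * (x * y) \<in> P"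
        by (intro self_module.subspace_add[OF P(1)] self_module.subspace_scale[OF P(1)] kl xy)
      also have "h ^ n * (h ^ m - k * x) + k * x * (h ^ n - l * y) + (k * l) * (x * y) = h ^ (m + n)"
        by (simp add: algebra_simps power_add)
      finally show False using P(3) by blast
    qed
  qed (use P P(3)[of 1] P(3)[of 0] in auto)
qed

lemma hom_component_add:
  fixes \<Phi> :: "('v, 'k::comm_ring_1) mpoly"
  shows "hom_component d (\<Phi> + \<Psi>) = hom_component d \<Phi> + hom_component d \<Psi>"
  by (rule poly_mapping_eqI) (simp add: lookup_hom_component lookup_add)

text \<open>Used to see that the colon ideal of a homogeneous ideal by a form is
  homogeneous.\<close>

lemma hom_component_mult_form:
  fixes \<phi> :: "('v::finite, 'k::comm_ring_1) mpoly"
  assumes \<phi>: "\<phi> \<in> forms e"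
  shows "hom_component (d + e) (\<Psi> * \<phi>) = hom_component d \<Psi> * \<phi>"
proof (induction \<Psi> rule: poly_mapping_single_add_induct)
  case (single \<alpha> c)
  have 1: "Poly_Mapping.single \<alpha> c \<in> forms (monom_degree \<alpha>)" by simp
  show ?case
    by (simp add: hom_component_forms[OF forms_mult[OF 1 \<phi>]] hom_component_forms[OF 1])
qed (simp add: distrib_right hom_component_add)

section \<open>Binary forms in two chosen variables, and points obtained from prime ideals\<close>

lemma line_eval_scale: "line_eval p (scale_poly c \<Phi>) = smult c (line_eval p \<Phi>)"
  by (simp add: scale_poly_conv_mult line_eval_mult monom_0)

text \<open>The binary form x^D q(y/x) with x = \<open>var v\<close> and y = \<open>var w\<close>.
  The degree D is a parameter of its own, so that q may have smaller degree.\<close>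

definition homogenize :: "'k::comm_ring_1 poly \<Rightarrow> nat \<Rightarrow> 'v \<Rightarrow> 'v \<Rightarrow> ('v, 'k) mpoly" where
  "homogenize q D v w = (\<Sum>i\<le>D. scale_poly (coeff q i) (var v ^ (D - i) * var w ^ i))"

lemma line_eval_homogenize:
  fixes p :: "'v::finite \<Rightarrow> 'k::field"
  assumes "p v = 1" "Polynomial.degree q \<le> D"
  shows "line_eval p (homogenize q D v w) = monom (poly q (p w)) D"
proof -
  have "line_eval p (homogenize q D v w) = (\<Sum>i\<le>D. monom (coeff q i * p w ^ i) D)"
    unfolding homogenize_def line_eval_sum
    by (rule sum.cong)
      (auto simp: line_eval_scale line_eval_mult line_eval_power monom_power assms mult_monom smult_monom)
  also have "\<dots> = monom (\<Sum>i\<le>D. coeff q i * p w ^ i) D"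
    by (rule poly_eqI) (simp add: coeff_sum)
  also have "(\<Sum>i\<le>D. coeff q i * p w ^ i) = poly q (p w)"
    unfolding poly_altdef
    by (rule sum.mono_neutral_right) (use assms in \<open>auto intro: coeff_eq_0\<close>)
  finally show ?thesis .
qed

lemma homogenize_add: "homogenize (p + q) D v w = homogenize p D v w + homogenize q D v w"
  for p q :: "'k::field poly"
  by (simp add: homogenize_def mpoly.scale_left_distrib sum.distrib)

lemma homogenize_smult: "homogenize (smult a q) D v w = scale_poly a (homogenize q D v w)"
  for q :: "'k::field poly"
  by (simp only: homogenize_def mpoly.scale_sum_right mpoly.scale_scale coeff_smult)

text \<open>Raising D by one multiplies the form by x, and multiplying q by its indeterminate
  multiplies the form by y. A root a of q thus becomes the linear factor y - a x.\<close>

lemma homogenize_linear_mult: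
  fixes q :: "'k::field poly"
  assumes "Polynomial.degree q \<le> D"
  shows "homogenize ([:- a, 1:] * q) (Suc D) v w =
    (var w - scale_poly a (var v)) * homogenize q D v w"
proof -
  have shift: "homogenize (pCons 0 q) (Suc D) v w = var w * homogenize q D v w"
    unfolding homogenize_def
    by (subst sum.atMost_Suc_shift) (simp add: sum_distrib_left mult_scale_poly_right mult_ac)
  have "homogenize q (Suc D) v w = (\<Sum>i\<le>D. scale_poly (coeff q i) (var v ^ (Suc D - i) * var w ^ i))"
    using assms by (simp add: homogenize_def coeff_eq_0)
  also have "\<dots> = var v * homogenize q D v w"
    unfolding homogenize_def sum_distrib_left
    by (rule sum.cong) (auto simp: Suc_diff_le mult_scale_poly_right mult_ac)
  finally have pad: "homogenize q (Suc D) v w = var v * homogenize q D v w" .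
  have "[:- a, 1:] * q = pCons 0 q + smult (- a) q" by simp
  then have "homogenize ([:- a, 1:] * q) (Suc D) v w =
      homogenize (pCons 0 q) (Suc D) v w + scale_poly (- a) (homogenize q (Suc D) v w)"
    by (simp only: homogenize_add homogenize_smult)
  also have "\<dots> = (var w - scale_poly a (var v)) * homogenize q D v w"
    by (simp add: shift pad left_diff_distrib mult_scale_poly_left)
  finally show ?thesis .
qed

lemma exists_homogenize_mem:
  fixes I :: "('v::finite, 'k::field) mpoly set"
  assumes I: "self_module.subspace I" and D: "hilbert_function I D \<le> D"
  obtains q where "q \<noteq> 0" "Polynomial.degree q \<le> D" "homogenize q D v w \<in> I"
proof -
  let ?b = "\<lambda>i. var v ^ (D - i) * var w ^ i :: ('v, 'k) mpoly"
  have bf: "?b i \<in> forms D" if "i \<in> {..D}" for i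
  proof -
    have "var v ^ (D - i) * var w ^ i \<in> (forms ((D - i) * 1 + i * 1) :: ('v, 'k) mpoly set)"
      by (intro forms_mult forms_power var_mem_forms)
    with that show ?thesis by simp
  qed
  have "\<not> indep_mod I ?b {..D}"
  proof
    assume "indep_mod I ?b {..D}"
    from card_le_hilbert_function[OF I _ this bf] D show False by simp
  qed
  then obtain c j where c: "(\<Sum>i\<le>D. scale_poly (c i) (?b i)) \<in> I" "j \<le> D" "c j \<noteq> 0"
    unfolding indep_mod_def by auto
  define q where "q = (\<Sum>i\<le>D. monom (c i) i)"
  have q: "coeff q i = (if i \<le> D then c i else 0)" for i
    by (simp add: q_def coeff_sum)
  show ?thesis
  proof (rule that[of q])
    show "q \<noteq> 0" using c q[of j] by auto
    show "Polynomial.degree q \<le> D" by (rule degree_le) (simp add: q)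
    have "homogenize q D v w = (\<Sum>i\<le>D. scale_poly (c i) (?b i))"
      unfolding homogenize_def by (rule sum.cong) (auto simp: q)
    with c show "homogenize q D v w \<in> I" by simp
  qed
qed

text \<open>Congruences modulo an ideal can be multiplied; applied below first to powers and then to
  monomials.\<close>

lemma ideal_prod_diff:
  assumes P: "self_module.subspace P" and "\<And>i. i \<in> A \<Longrightarrow> f i - g i \<in> P"
  shows "(\<Prod>i\<in>A. f i) - (\<Prod>i\<in>A. g i) \<in> (P :: 'r::comm_ring_1 set)"
  using assms(2)
proof (induction A rule: infinite_finite_induct)
  case (insert i A)
  have "prod f (insert i A) - prod g (insert i A) = f i * (prod f A - prod g A) + prod g A * (f i - g i)"
    using insert(1,2) by (simp add: algebra_simps)
  also have "\<dots> \<in> P"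
    by (intro self_module.subspace_add[OF P] self_module.subspace_scale[OF P] insert) auto
  finally show ?case .
qed (simp_all add: self_module.subspace_0[OF P])

lemma prime_power_mem:
  fixes P :: "'r::comm_ring_1 set"
  assumes "1 \<notin> P" "\<And>x y. x * y \<in> P \<Longrightarrow> x \<in> P \<or> y \<in> P" "x ^ n \<in> P"
  shows "x \<in> P"
  using assms(3) by (induction n) (use assms(1,2) in auto)

lemma single_0_prod:
  "(\<Prod>i\<in>A. Poly_Mapping.single 0 (c i)) = (Poly_Mapping.single 0 (\<Prod>i\<in>A. c i) :: ('v, 'k::comm_ring_1) mpoly)"
  by (induction A rule: infinite_finite_induct) (auto simp: mult_single)

lemma single_0_power:
  "Poly_Mapping.single 0 c ^ n = (Poly_Mapping.single 0 (c ^ n) :: ('v, 'k::comm_ring_1) mpoly)"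
  by (induction n) (auto simp: mult_single)

text \<open>
  Modulo a prime ideal containing \<open>Q\<close> but not \<open>x = var v\<close>, a form of degree \<open>D\<close> in \<open>x\<close> and
  \<open>y = var w\<close> splits into linear factors, so that \<open>y\<close> is congruent to a multiple of \<open>x\<close>.
\<close>

lemma exists_point_avoiding:
  fixes Q :: "('v::finite, 'k::alg_closed_field) mpoly set"
  assumes Q: "self_module.subspace Q" and hom: "\<And>\<Phi> d. \<Phi> \<in> Q \<Longrightarrow> hom_component d \<Phi> \<in> Q"
    and D: "hilbert_function Q D \<le> D" and f: "f \<in> forms e" and avoid: "\<And>n. (var v * f) ^ n \<notin> Q"
  obtains p where "p v = 1" "\<And>\<Phi>. \<Phi> \<in> Q \<Longrightarrow> line_eval p \<Phi> = 0" "line_eval p f \<noteq> 0"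
proof -
  obtain P where P: "self_module.subspace P" "Q \<subseteq> P" "var v * f \<notin> P" "1 \<notin> P"
    and prime: "\<And>x y. x * y \<in> P \<Longrightarrow> x \<in> P \<or> y \<in> P"
    using exists_prime_ideal_avoiding[OF Q avoid] by metis
  have fP: "f \<notin> P" using P(3) self_module.subspace_scale[OF P(1)] by blast
  have vP: "var v \<notin> P" using P(3) self_module.subspace_scale[OF P(1), of "var v" f] by (auto simp: mult.commute)
  have powP: "var v ^ n \<notin> P" for n using prime_power_mem[OF P(4) prime, of "var v" n] vP by blast
  have root: "\<exists>a. var w - scale_poly a (var v) \<in> P"
    if "q \<noteq> 0" "Polynomial.degree q \<le> D" "homogenize q D v w \<in> P" for q D w
    using that
  proof (induction D arbitrary: q)
    case 0
    then have "scale_poly (coeff q 0) 1 \<in> P" by (simp add: homogenize_def)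
    moreover have "coeff q 0 \<noteq> 0"
      using "0.prems"(1,2) leading_coeff_0_iff[of q] by simp
    ultimately show ?case using P(4) ideal_scale_iff[OF P(1)] by blast
  next
    case (Suc D)
    show ?case
    proof (cases "Polynomial.degree q = 0")
      case True
      have "homogenize q (Suc D) v w = (\<Sum>i\<le>Suc D. if i = 0 then scale_poly (coeff q 0) (var v ^ Suc D) else 0)"
        unfolding homogenize_def by (rule sum.cong) (use True in \<open>auto simp: coeff_eq_0\<close>)
      also have "\<dots> = scale_poly (coeff q 0) (var v ^ Suc D)" by simp
      finally have "scale_poly (coeff q 0) (var v ^ Suc D) \<in> P" using Suc.prems by simp
      moreover have "coeff q 0 \<noteq> 0" using Suc.prems(1) True leading_coeff_0_iff[of q] by simp
      ultimately have "var v ^ Suc D \<in> P" using ideal_scale_iff[OF P(1)] by blast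
      with powP show ?thesis by blast
    next
      case False
      then obtain a where "poly q a = 0" using alg_closed_imp_poly_has_root[of q] by auto
      then obtain r where r: "q = [:- a, 1:] * r" by (auto simp: poly_eq_0_iff_dvd dvd_def)
      have r0: "r \<noteq> 0" using Suc.prems(1) r by auto
      have deg: "Polynomial.degree r \<le> D"
        using Suc.prems(2) r0 unfolding r by (subst (asm) degree_mult_eq) auto
      have "(var w - scale_poly a (var v)) * homogenize r D v w \<in> P"
        using Suc.prems(3) unfolding r homogenize_linear_mult[OF deg] .
      then show ?thesis using prime Suc.IH[OF r0 deg] by blast
    qed
  qed
  have "\<exists>a. var w - scale_poly a (var v) \<in> P" for w
  proof -
    obtain q where "q \<noteq> 0" "Polynomial.degree q \<le> D" "homogenize q D v w \<in> Q"
      using exists_homogenize_mem[OF Q D, of v w thesis] by blast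
    then show ?thesis using P(2) by (intro root[of q D w]) auto
  qed
  then obtain a where a: "\<And>w. var w - scale_poly (a w) (var v) \<in> P" by metis
  \<comment> \<open>The point is normalized to have coordinate 1 at v. This respects the
    congruences, since \<open>var v\<close> is congruent to itself.\<close>
  define p where "p = a(v := 1)"
  have p: "var w - scale_poly (p w) (var v) \<in> P" for w
    using a self_module.subspace_0[OF P(1)] by (simp add: p_def)
  have mon: "mon \<alpha> - scale_poly (mon_eval p \<alpha>) (var v ^ monom_degree \<alpha>) \<in> P" for \<alpha>
  proof -
    have "(\<Prod>w\<in>UNIV. var w ^ Poly_Mapping.lookup \<alpha> w) -
        (\<Prod>w\<in>UNIV. scale_poly (p w) (var v) ^ Poly_Mapping.lookup \<alpha> w) \<in> P"
    proof (rule ideal_prod_diff[OF P(1)])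
      fix w
      have "(\<Prod>i<Poly_Mapping.lookup \<alpha> w. var w) - (\<Prod>i<Poly_Mapping.lookup \<alpha> w. scale_poly (p w) (var v)) \<in> P"
        by (rule ideal_prod_diff[OF P(1) p])
      then show "var w ^ Poly_Mapping.lookup \<alpha> w - scale_poly (p w) (var v) ^ Poly_Mapping.lookup \<alpha> w \<in> P"
        by simp
    qed
    also have "(\<Prod>w\<in>UNIV. scale_poly (p w) (var v) ^ Poly_Mapping.lookup \<alpha> w) =
        scale_poly (mon_eval p \<alpha>) (var v ^ monom_degree \<alpha>)"
      by (simp add: scale_poly_conv_mult power_mult_distrib prod.distrib single_0_power single_0_prod
          mon_eval_def monom_degree_UNIV power_sum)
    finally show ?thesis by (simp only: mon_eq_prod_var)
  qed
  \<comment> \<open>Modulo \<open>P\<close>, a form of degree d equals its value at p times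
    \<open>var v ^ d\<close>. No power of \<open>var v\<close> lies in \<open>P\<close>, so
    membership in \<open>P\<close> is the same as vanishing at p.\<close>
  have form: "\<Phi> - scale_poly (coeff (line_eval p \<Phi>) d) (var v ^ d) \<in> P" if \<Phi>: "\<Phi> \<in> forms d" for \<Phi> d
  proof -
    have keys: "{\<alpha> \<in> Poly_Mapping.keys \<Phi>. monom_degree \<alpha> = d} = Poly_Mapping.keys \<Phi>"
      using \<Phi> by (auto simp: forms_def)
    have "(\<Sum>\<alpha>\<in>Poly_Mapping.keys \<Phi>. scale_poly (Poly_Mapping.lookup \<Phi> \<alpha>)
        (mon \<alpha> - scale_poly (mon_eval p \<alpha>) (var v ^ d))) \<in> P" (is "?S \<in> P")
    proof (intro self_module.subspace_sum[OF P(1)] ideal_scale[OF P(1)])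
      fix \<alpha> assume "\<alpha> \<in> Poly_Mapping.keys \<Phi>"
      then show "mon \<alpha> - scale_poly (mon_eval p \<alpha>) (var v ^ d) \<in> P"
        using \<Phi> mon[of \<alpha>] by (auto simp: forms_def)
    qed
    also have "?S = \<Phi> - scale_poly (coeff (line_eval p \<Phi>) d) (var v ^ d)"
      unfolding coeff_line_eval keys
      by (simp add: mpoly.scale_right_diff_distrib sum_subtractf poly_mapping_sum_single
          mpoly.scale_sum_left)
    finally show ?thesis .
  qed
  show ?thesis
  proof (rule that[of p])
    show "p v = 1" by (simp add: p_def)
    show "line_eval p \<Phi> = 0" if "\<Phi> \<in> Q" for \<Phi>
    proof (rule poly_eqI)
      fix d
      let ?\<Phi> = "hom_component d \<Phi>"
      have "?\<Phi> \<in> P" using hom[OF that] P(2) by blast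
      then have "?\<Phi> - (?\<Phi> - scale_poly (coeff (line_eval p ?\<Phi>) d) (var v ^ d)) \<in> P"
        by (rule self_module.subspace_diff[OF P(1) _ form[OF hom_component_mem_forms]])
      then have "scale_poly (coeff (line_eval p \<Phi>) d) (var v ^ d) \<in> P"
        by (simp add: line_eval_hom_component)
      with powP[of d] show "coeff (line_eval p \<Phi>) d = coeff 0 d"
        using ideal_scale_iff[OF P(1)] by auto
    qed
    show "line_eval p f \<noteq> 0"
    proof
      assume "line_eval p f = 0"
      with form[OF f] fP show False by simp
    qed
  qed
qed

text \<open>Pigeonhole: a monomial whose degree is m times the number of variables is divisible by
  the m-th power of one of them. Hence all forms of that degree multiply \<Phi> into
  \<open>I\<close>, and saturation applies.\<close>

lemma mem_if_var_powers_mem: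
  fixes I :: "('v::finite, 'k::field) mpoly set"
  assumes I: "proj_subscheme I" and m: "\<And>v. var v ^ m * \<Phi> \<in> I"
  shows "\<Phi> \<in> I"
proof (rule saturationD[OF I])
  note sub = proj_subscheme_subspace[OF I]
  fix \<Psi> :: "('v, 'k) mpoly" assume \<Psi>: "\<Psi> \<in> forms (CARD('v) * m)"
  have "mon \<alpha> * \<Phi> \<in> I" if \<alpha>: "monom_degree \<alpha> = CARD('v) * m" for \<alpha>
  proof -
    have "\<exists>v. m \<le> Poly_Mapping.lookup \<alpha> v"
    proof (rule ccontr)
      assume "\<not> ?thesis"
      then have "(\<Sum>v\<in>UNIV. Poly_Mapping.lookup \<alpha> v) < (\<Sum>v\<in>(UNIV :: 'v set). m)"
        by (intro sum_strict_mono) (auto simp: not_le)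
      with \<alpha> show False by (simp add: monom_degree_UNIV)
    qed
    then obtain v where v: "m \<le> Poly_Mapping.lookup \<alpha> v" ..
    have "\<alpha> = (\<alpha> - Poly_Mapping.single v m) + Poly_Mapping.single v m"
      by (rule poly_mapping_eqI) (use v in \<open>auto simp: lookup_add lookup_minus lookup_single when_def\<close>)
    then have "(mon \<alpha> :: ('v, 'k) mpoly) =
        mon (\<alpha> - Poly_Mapping.single v m) * mon (Poly_Mapping.single v m)"
      by (simp add: mult_single)
    also have "mon (Poly_Mapping.single v m) = (var v ^ m :: ('v, 'k) mpoly)"
      by (simp add: var_power)
    finally have "mon \<alpha> * \<Phi> = mon (\<alpha> - Poly_Mapping.single v m) * (var v ^ m * \<Phi>)"
      by (simp add: mult.assoc)
    then show ?thesis using self_module.subspace_scale[OF sub m] by simp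
  qed
  then have "(\<Sum>\<alpha>\<in>Poly_Mapping.keys \<Psi>. scale_poly (Poly_Mapping.lookup \<Psi> \<alpha>) (mon \<alpha> * \<Phi>)) \<in> I"
    using \<Psi> by (intro self_module.subspace_sum[OF sub] ideal_scale[OF sub]) (auto simp: forms_def)
  also have "(\<Sum>\<alpha>\<in>Poly_Mapping.keys \<Psi>. scale_poly (Poly_Mapping.lookup \<Psi> \<alpha>) (mon \<alpha> * \<Phi>)) = \<Psi> * \<Phi>"
    by (simp add: mult_scale_poly_left[symmetric] sum_distrib_right[symmetric] poly_mapping_sum_single)
  finally show "\<Psi> * \<Phi> \<in> I" .
qed

text \<open>Closed under scaling, so it is finite only after some coordinate has been
  normalized.\<close>

definition zero_cone :: "('v::finite, 'k::comm_ring_1) mpoly set \<Rightarrow> ('v \<Rightarrow> 'k) set" where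
  "zero_cone I = {p. \<forall>\<Phi>\<in>I. line_eval p \<Phi> = 0}"

lemma zero_dim_hilbert_function_le:
  assumes "zero_dim_subscheme I"
  obtains D where "hilbert_function I D \<le> D"
proof -
  have "eventually (\<lambda>d. hilbert_function I d = scheme_degree I \<and> scheme_degree I \<le> d) sequentially"
    using eventually_scheme_degree[OF assms] eventually_ge_at_top by (rule eventually_conj)
  then obtain D where "hilbert_function I D = scheme_degree I \<and> scheme_degree I \<le> D"
    unfolding eventually_sequentially by blast
  with that[of D] show ?thesis by simp
qed

text \<open>Nullstellensatz in dimension zero. If a form f is not in \<open>I\<close>, saturation
  gives a variable x with x f not in \<open>I\<close>; since \<open>I\<close> is radical, no power
  of x f lies in \<open>I\<close>, which yields a point of the cone where f does not vanish.\<close>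

lemma radical_eq_cone_ideal:
  fixes I :: "('v::finite, 'k::alg_closed_field) mpoly set"
  assumes I: "zero_dim_subscheme I" and rad: "\<And>\<Phi> m. \<Phi> ^ m \<in> I \<Longrightarrow> \<Phi> \<in> I"
  shows "I = cone_ideal (zero_cone I)"
proof
  have proj: "proj_subscheme I" using I by (simp add: zero_dim_subscheme_def)
  note sub = proj_subscheme_subspace[OF proj]
  have hom: "hom_component d \<Phi> \<in> I" if "\<Phi> \<in> I" for \<Phi> d
    using proj that by (simp add: proj_subscheme_def)
  obtain D where D: "hilbert_function I D \<le> D" using zero_dim_hilbert_function_le[OF I] .
  show "I \<subseteq> cone_ideal (zero_cone I)" by (auto simp: cone_ideal_def zero_cone_def)
  show "cone_ideal (zero_cone I) \<subseteq> I"
  proof (rule homogeneous_ideal_eqI[OF sub])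
    fix \<Phi> d assume "\<Phi> \<in> cone_ideal (zero_cone I)"
    then have f: "hom_component d \<Phi> \<in> cone_ideal (zero_cone I)" (is "?f \<in> _")
      by (rule cone_ideal_homogeneous)
    show "?f \<in> I"
    proof (rule ccontr)
      assume "?f \<notin> I"
      then obtain v where "var v ^ 1 * ?f \<notin> I"
        using mem_if_var_powers_mem[OF proj, of 1 ?f] by blast
      then have "(var v * ?f) ^ n \<notin> I" for n using rad[of "var v * ?f" n] by auto
      from exists_point_avoiding[OF sub hom D hom_component_mem_forms this]
      obtain p where "\<And>\<Psi>. \<Psi> \<in> I \<Longrightarrow> line_eval p \<Psi> = 0" "line_eval p ?f \<noteq> 0" by metis
      with f show False by (auto simp: cone_ideal_def zero_cone_def)
    qed
  qed
qed

section \<open>A quadric that is a nonzerodivisor\<close>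

lemma hilbert_function_antimono:
  fixes I Q :: "('v::finite, 'k::field) mpoly set"
  assumes "self_module.subspace I" "self_module.subspace Q" "I \<subseteq> Q"
  shows "hilbert_function Q d \<le> hilbert_function I d"
proof -
  obtain b where b: "\<And>j. j < hilbert_function Q d \<Longrightarrow> b j \<in> forms d"
    "indep_mod Q b {..<hilbert_function Q d}"
    using hilbert_function_basis[OF assms(2), of d thesis] by blast
  have "indep_mod I b {..<hilbert_function Q d}"
    using b(2) assms(3) unfolding indep_mod_def by blast
  with b(1) card_le_hilbert_function[OF assms(1), of "{..<hilbert_function Q d}" b d]
  show ?thesis by simp
qed

text \<open>In a finite field, 1 plus the product of all x - a would be a nonconstant polynomial
  without a root.\<close>

lemma infinite_UNIV_alg_closed: "infinite (UNIV :: 'k::alg_closed_field set)"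
proof
  assume fin: "finite (UNIV :: 'k set)"
  let ?q = "\<Prod>a\<in>UNIV. [:- a, 1 :: 'k:]"
  have "Polynomial.degree ?q = CARD('k)"
    by (subst degree_prod_eq_sum_degree) auto
  then have "Polynomial.degree (1 + ?q) > 0"
    using fin by (subst degree_add_eq_right) (auto simp: finite_UNIV_card_ge_0)
  then obtain z where "poly (1 + ?q) z = 0"
    using alg_closed_imp_poly_has_root by blast
  moreover have "poly ?q z = 0"
    using fin by (auto simp: poly_prod)
  ultimately show False by simp
qed

text \<open>The coefficients are taken on the curve \<open>c v = t ^ e v\<close> with distinct
  exponents. The value of the quadric at p is then a polynomial in t whose coefficients are the
  squares of the coordinates of p, hence nonzero, and t only has to avoid finitely many
  roots.\<close>

lemma exists_diagonal_quadric_nonvanishing: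
  fixes V :: "('v::finite \<Rightarrow> 'k::alg_closed_field) set"
  assumes fin: "finite V" and V: "\<And>p. p \<in> V \<Longrightarrow> \<exists>v. p v \<noteq> 0"
  obtains c where "\<And>p. p \<in> V \<Longrightarrow> (\<Sum>v\<in>UNIV. c v * p v ^ 2) \<noteq> 0"
proof -
  obtain e :: "'v \<Rightarrow> nat" where e: "inj e"
    using ex_bij_betw_finite_nat[of "UNIV :: 'v set"] by (auto simp: bij_betw_def)
  define r where "r p = (\<Sum>v\<in>UNIV. monom (p v ^ 2) (e v))" for p :: "'v \<Rightarrow> 'k"
  have "r p \<noteq> 0" if "p \<in> V" for p
  proof -
    obtain v where v: "p v \<noteq> 0" using V[OF \<open>p \<in> V\<close>] by blast
    have "coeff (r p) (e v) = (\<Sum>w\<in>UNIV. if w = v then p v ^ 2 else 0)"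
      unfolding r_def coeff_sum by (rule sum.cong) (use e in \<open>auto simp: inj_eq\<close>)
    with v show ?thesis by auto
  qed
  then have "(\<Prod>p\<in>V. r p) \<noteq> 0" using fin by simp
  then have "finite {t. poly (\<Prod>p\<in>V. r p) t = 0}" by (rule poly_roots_finite)
  then obtain t where t: "poly (\<Prod>p\<in>V. r p) t \<noteq> 0"
    using infinite_UNIV_alg_closed by (metis (mono_tags, lifting) UNIV_eq_I mem_Collect_eq)
  show ?thesis
  proof (rule that[of "\<lambda>v. t ^ e v"])
    fix p assume "p \<in> V"
    with t fin have "poly (r p) t \<noteq> 0" by (simp add: poly_prod)
    then show "(\<Sum>v\<in>UNIV. t ^ e v * p v ^ 2) \<noteq> 0"
      by (simp add: r_def poly_sum poly_monom mult.commute)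
  qed
qed

text \<open>Choose g nonzero at every point of the scheme. If g \<phi> were in \<open>I\<close> for
  a form \<phi> outside \<open>I\<close>, then the colon ideal of \<open>I\<close> by \<phi> would
  contain \<open>I\<close> and g. Saturation shows that it misses all powers of some variable, so it
  has a zero, and this is a point of the scheme at which g vanishes.\<close>

lemma exists_diagonal_quadric_nonzerodivisor:
  fixes I :: "('v::finite, 'k::alg_closed_field) mpoly set"
  assumes I: "zero_dim_subscheme I"
  shows "\<exists>c. \<forall>e. \<forall>\<phi>\<in>forms e. (\<Sum>v\<in>UNIV. scale_poly (c v) (var v ^ 2)) * \<phi> \<in> I \<longrightarrow> \<phi> \<in> I"
proof -
  have proj: "proj_subscheme I" using I by (simp add: zero_dim_subscheme_def)
  note sub = proj_subscheme_subspace[OF proj]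
  have hom: "hom_component d \<Phi> \<in> I" if "\<Phi> \<in> I" for \<Phi> d
    using proj that by (simp add: proj_subscheme_def)
  obtain D where D: "hilbert_function I D \<le> D" using zero_dim_hilbert_function_le[OF I] .
  \<comment> \<open>Each projective point is represented once for every nonzero coordinate, scaled
    to 1 there. In each chart the remaining coordinates are roots of fixed nonzero
    polynomials.\<close>
  define V where "V = (\<Union>v. {p \<in> zero_cone I. p v = 1})"
  have "finite {p \<in> zero_cone I. p v = 1}" for v
  proof -
    have "\<exists>q. q \<noteq> 0 \<and> Polynomial.degree q \<le> D \<and> homogenize q D v w \<in> I" for w
    proof -
      obtain q where "q \<noteq> 0" "Polynomial.degree q \<le> D" "homogenize q D v w \<in> I"
        using exists_homogenize_mem[OF sub D, of v w thesis] by blast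
      then show ?thesis by blast
    qed
    then obtain q where q: "\<And>w. q w \<noteq> 0" "\<And>w. Polynomial.degree (q w) \<le> D"
      "\<And>w. homogenize (q w) D v w \<in> I" by metis
    have "{p \<in> zero_cone I. p v = 1} \<subseteq> PiE UNIV (\<lambda>w. {x. poly (q w) x = 0})"
    proof
      fix p assume p: "p \<in> {p \<in> zero_cone I. p v = 1}"
      have "poly (q w) (p w) = 0" for w
        using p q(3)[of w] line_eval_homogenize[of p v "q w" D w] q(2)[of w]
        by (auto simp: zero_cone_def)
      then show "p \<in> PiE UNIV (\<lambda>w. {x. poly (q w) x = 0})" by auto
    qed
    moreover have "finite (PiE UNIV (\<lambda>w. {x. poly (q w) x = 0}))"
      by (intro finite_PiE poly_roots_finite q) simp
    ultimately show ?thesis by (rule finite_subset)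
  qed
  then have "finite V" by (simp add: V_def)
  moreover have "\<exists>v. p v \<noteq> 0" if "p \<in> V" for p
  proof -
    obtain v where "p v = 1" using \<open>p \<in> V\<close> by (auto simp: V_def)
    then show ?thesis by (intro exI[of _ v]) simp
  qed
  ultimately obtain c where c: "\<And>p. p \<in> V \<Longrightarrow> (\<Sum>v\<in>UNIV. c v * p v ^ 2) \<noteq> 0"
    using exists_diagonal_quadric_nonvanishing by blast
  let ?g = "\<Sum>v\<in>UNIV. scale_poly (c v) (var v ^ 2) :: ('v, 'k) mpoly"
  have g: "coeff (line_eval p ?g) 2 = (\<Sum>v\<in>UNIV. c v * p v ^ 2)" for p
    by (simp add: line_eval_sum line_eval_scale line_eval_power monom_power coeff_sum)
  show ?thesis
  proof (intro exI[of _ c] allI ballI impI, rule ccontr)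
    fix e \<phi> assume \<phi>: "\<phi> \<in> forms e" "?g * \<phi> \<in> I" "\<phi> \<notin> I"
    define Q where "Q = {\<Psi>. \<Psi> * \<phi> \<in> I}"
    have subQ: "self_module.subspace Q"
      using self_module.subspace_0[OF sub] self_module.subspace_add[OF sub] self_module.subspace_scale[OF sub]
      by (auto simp: self_module.subspace_def Q_def distrib_right mult.assoc)
    have IQ: "I \<subseteq> Q"
      using self_module.subspace_scale[OF sub] by (auto simp: Q_def mult.commute)
    have homQ: "hom_component d \<Psi> \<in> Q" if "\<Psi> \<in> Q" for \<Psi> d
      using hom[of "\<Psi> * \<phi>" "d + e"] that by (simp add: Q_def hom_component_mult_form[OF \<phi>(1)])
    have DQ: "hilbert_function Q D \<le> D"
      using hilbert_function_antimono[OF sub subQ IQ, of D] D by simp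
    have "\<exists>v. \<forall>n. var v ^ n \<notin> Q"
    proof (rule ccontr)
      assume "\<not> ?thesis"
      then obtain m where m: "\<And>v. var v ^ m v \<in> Q" by metis
      have "var v ^ (\<Sum>v\<in>UNIV. m v) * \<phi> \<in> I" for v
      proof -
        have "var v ^ (\<Sum>v\<in>UNIV. m v) = var v ^ ((\<Sum>v\<in>UNIV. m v) - m v) * (var v ^ m v :: ('v, 'k) mpoly)"
          by (simp add: power_add[symmetric] member_le_sum)
        also have "\<dots> \<in> Q" by (rule self_module.subspace_scale[OF subQ m])
        finally show ?thesis by (simp add: Q_def)
      qed
      from mem_if_var_powers_mem[OF proj this] \<phi>(3) show False by blast
    qed
    \<comment> \<open>The trivial form 1 plays the part of f, because any zero of \<open>Q\<close>
      with nonzero coordinate at v will do.\<close>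
    then obtain v where "(var v * 1) ^ n \<notin> Q" for n by auto
    from exists_point_avoiding[OF subQ homQ DQ one_mem_forms this]
    obtain p where p: "p v = 1" "\<And>\<Phi>. \<Phi> \<in> Q \<Longrightarrow> line_eval p \<Phi> = 0" by metis
    have "p \<in> V" using p IQ by (auto simp: V_def zero_cone_def)
    moreover have "line_eval p ?g = 0" using \<phi>(2) by (intro p(2)) (simp add: Q_def)
    ultimately show False using c g[of p] by simp
  qed
qed


section \<open>Smooth schemes\<close>

text \<open>A smooth scheme is the limit of the constant family over the Laurent series.\<close>

lemma smooth_zero_dim_imp_smoothable:
  fixes I :: "('v::finite, 'k::field) mpoly set"
  assumes I: "smooth_zero_dim I"
  shows "smoothable I"
proof -
  interpret ac: field_embedding "to_ac :: 'k \<Rightarrow> 'k alg_closure" by (rule field_embedding_to_ac)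
  interpret fls: field_embedding "fls_const :: 'k alg_closure \<Rightarrow> 'k alg_closure fls"
    by (rule field_embedding_fls_const)
  interpret ac': field_embedding "to_ac :: 'k alg_closure fls \<Rightarrow> 'k alg_closure fls alg_closure"
    by (rule field_embedding_to_ac)
  have zI: "zero_dim_subscheme I" using I by (simp add: smooth_zero_dim_def)
  then have subI: "self_module.subspace I"
    by (simp add: zero_dim_subscheme_def proj_subscheme_subspace)
  define G where "G = geometric_ideal I"
  define J where "J = base_change fls_const G"
  have zG: "zero_dim_subscheme G"
    unfolding G_def geometric_ideal_base_change by (rule ac.zero_dim_subscheme_base_change[OF zI])
  \<comment> \<open>\<open>smooth_zero_dim\<close> tests powers in the geometric ideal itself, so
    the Nullstellensatz applies directly over the closure.\<close>
  have G: "G = cone_ideal (zero_cone G)"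
    by (rule radical_eq_cone_ideal[OF zG]) (use I in \<open>auto simp: smooth_zero_dim_def G_def\<close>)
  have subG: "self_module.subspace G"
    using zG by (simp add: zero_dim_subscheme_def proj_subscheme_subspace)
  have zJ: "zero_dim_subscheme J"
    unfolding J_def by (rule fls.zero_dim_subscheme_base_change[OF zG])
  \<comment> \<open>The points of \<open>J\<close> are those of \<open>G\<close> with constant
    coordinates, and this description carries over to the algebraic closure of the Laurent series
    field.\<close>
  have J: "J = cone_ideal ((\<lambda>p v. fls_const (p v)) ` zero_cone G)"
    unfolding J_def by (subst G) (rule fls.base_change_cone_ideal)
  have "\<Phi> \<in> geometric_ideal J" if "\<Phi> ^ m \<in> geometric_ideal J" for \<Phi> m
    using that cone_ideal_radical
    unfolding geometric_ideal_base_change J ac'.base_change_cone_ideal by blast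
  with zJ have "smooth_zero_dim J" unfolding smooth_zero_dim_def by blast
  moreover have "scheme_degree J = scheme_degree I"
    unfolding J_def fls.scheme_degree_base_change[OF subG]
    unfolding G_def geometric_ideal_base_change by (rule ac.scheme_degree_base_change[OF subI])
  moreover have "limit_ideal J = geometric_ideal I"
    unfolding J_def G_def[symmetric] using zG
    by (intro limit_ideal_base_change) (simp add: zero_dim_subscheme_def)
  ultimately show ?thesis using zI unfolding smoothable_def by blast
qed

section \<open>Vanishing ideals of finitely many points\<close>

lemma line_eval_diff: "line_eval p (\<Phi> - \<Psi>) = line_eval p \<Phi> - line_eval p \<Psi>"
  using line_eval_add[of p "\<Phi> - \<Psi>" \<Psi>] by simp

text \<open>A further point imposes at most one linear condition in degree d, so a single additional
  form u spans what is missing.\<close>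

lemma hilbert_function_cone_ideal_insert:
  fixes p :: "'v::finite \<Rightarrow> 'k::field"
  shows "hilbert_function (cone_ideal (insert p \<Gamma>)) d \<le> Suc (hilbert_function (cone_ideal \<Gamma>) d)"
proof -
  let ?I = "cone_ideal \<Gamma>" and ?I' = "cone_ideal (insert p \<Gamma>)"
  obtain b where b: "\<And>j. j < hilbert_function ?I d \<Longrightarrow> b j \<in> forms d"
    "spans_mod ?I b {..<hilbert_function ?I d} (forms d)"
    using hilbert_function_basis[OF cone_ideal_subspace, of \<Gamma> d thesis] by blast
  have "\<exists>u\<in>?I \<inter> forms d. \<forall>\<Phi>\<in>?I \<inter> forms d. \<exists>a. \<Phi> - scale_poly a u \<in> ?I'"
  proof (cases "\<exists>u\<in>?I \<inter> forms d. line_eval p u \<noteq> 0")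
    case True
    then obtain u where u: "u \<in> ?I" "u \<in> forms d" "line_eval p u \<noteq> 0" by blast
    then have nz: "coeff (line_eval p u) d \<noteq> 0"
      using line_eval_forms[of u d p] by auto
    have "\<Phi> - scale_poly (coeff (line_eval p \<Phi>) d / coeff (line_eval p u) d) u \<in> ?I'" (is "?\<Psi> \<in> _")
      if \<Phi>: "\<Phi> \<in> ?I" "\<Phi> \<in> forms d" for \<Phi>
    proof -
      have "?\<Psi> \<in> ?I"
        by (intro self_module.subspace_diff[OF cone_ideal_subspace] ideal_scale[OF cone_ideal_subspace] \<Phi> u)
      moreover have "?\<Psi> \<in> forms d"
        by (intro mpoly.subspace_diff[OF subspace_forms] forms_scale \<Phi> u)
      moreover have "coeff (line_eval p (\<Phi> - scale_poly a u)) d =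
          coeff (line_eval p \<Phi>) d - a * coeff (line_eval p u) d" for a
        by (simp add: line_eval_diff line_eval_scale)
      ultimately show ?thesis
        using nz line_eval_forms[of ?\<Psi> d p] by (auto simp: cone_ideal_def)
    qed
    with u show ?thesis by blast
  next
    case False
    \<comment> \<open>Here the new condition already holds on the degree d part, and u = 0
      serves.\<close>
    then have "\<Phi> - scale_poly 0 0 \<in> ?I'" if "\<Phi> \<in> ?I \<inter> forms d" for \<Phi>
      using that by (auto simp: cone_ideal_def)
    then show ?thesis
      using self_module.subspace_0[OF cone_ideal_subspace] by (intro bexI[of _ 0]) auto
  qed
  then obtain u where u: "u \<in> forms d"
    "\<And>\<Phi>. \<Phi> \<in> ?I \<Longrightarrow> \<Phi> \<in> forms d \<Longrightarrow> \<exists>a. \<Phi> - scale_poly a u \<in> ?I'" by blast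
  define b' where "b' j = (if j < hilbert_function ?I d then b j else u)" for j
  have b'f: "b' j \<in> forms d" for j using b(1) u(1) by (simp add: b'_def)
  have "spans_mod ?I' b' {..hilbert_function ?I d} (forms d)"
    unfolding spans_mod_def
  proof
    fix \<Phi> :: "('v, 'k) mpoly" assume \<Phi>: "\<Phi> \<in> forms d"
    then obtain c where c: "\<Phi> - (\<Sum>j<hilbert_function ?I d. scale_poly (c j) (b j)) \<in> ?I"
      using b(2) by (auto simp: spans_mod_def)
    have "\<Phi> - (\<Sum>j<hilbert_function ?I d. scale_poly (c j) (b j)) \<in> forms d"
      using b(1) by (intro mpoly.subspace_diff[OF subspace_forms] forms_sum forms_scale \<Phi>) auto
    from u(2)[OF c this] obtain a
      where a: "\<Phi> - (\<Sum>j<hilbert_function ?I d. scale_poly (c j) (b j)) - scale_poly a u \<in> ?I'" ..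
    let ?c = "\<lambda>j. if j < hilbert_function ?I d then c j else a"
    have "(\<Sum>j\<le>hilbert_function ?I d. scale_poly (?c j) (b' j)) =
        (\<Sum>j<hilbert_function ?I d. scale_poly (c j) (b j)) + scale_poly a u"
      by (simp add: lessThan_Suc_atMost[symmetric] b'_def)
    with a have "\<Phi> - (\<Sum>j\<le>hilbert_function ?I d. scale_poly (?c j) (b' j)) \<in> ?I'"
      by (simp add: diff_diff_eq)
    then show "\<exists>c. \<Phi> - (\<Sum>j\<le>hilbert_function ?I d. scale_poly (c j) (b' j)) \<in> ?I'" by (rule exI[of _ ?c])
  qed
  from hilbert_function_le_card[OF cone_ideal_subspace _ this b'f] show ?thesis by simp
qed

lemma hilbert_function_cone_ideal_le:
  fixes \<Gamma> :: "('v::finite \<Rightarrow> 'k::field) set"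
  assumes "finite \<Gamma>"
  shows "hilbert_function (cone_ideal \<Gamma>) d \<le> card \<Gamma>"
  using assms
proof induction
  case empty
  have "(forms d :: ('v, 'k) mpoly set) \<inter> cone_ideal {} = forms d" by (auto simp: cone_ideal_def)
  then show ?case by (simp add: hilbert_function_def Int_commute)
next
  case (insert p \<Gamma>)
  then show ?case using hilbert_function_cone_ideal_insert[of p \<Gamma> d] by simp
qed

lemma mono_bounded_nat_eventually_const:
  fixes f :: "nat \<Rightarrow> nat"
  assumes "mono f" "\<And>n. f n \<le> B"
  obtains N where "\<And>n. N \<le> n \<Longrightarrow> f n = f N"
proof -
  have "range f \<subseteq> {..B}" using assms(2) by auto
  then have fin: "finite (range f)" by (rule finite_subset) simp
  then have "Max (range f) \<in> range f" by (rule Max_in) simp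
  then obtain N where N: "Max (range f) = f N" by (rule rangeE)
  show ?thesis
  proof (rule that[of N], rule antisym)
    fix n assume "N \<le> n"
    then show "f N \<le> f n" using assms(1) by (rule monoD[rotated])
    show "f n \<le> f N" unfolding N[symmetric] using fin by (rule Max_ge) simp
  qed
qed

text \<open>The linear form l misses all the points and is a nonzerodivisor modulo their ideal. This
  gives saturation, a nondecreasing Hilbert function, and powers of l as nonzero elements in every
  degree; the number of vectors bounds the function from above. Over a small finite field no such l
  need exist, hence the assumption.\<close>

lemma smooth_zero_dim_cone_ideal:
  fixes \<Gamma> :: "('v::finite \<Rightarrow> 'k::field) set"
  assumes fin: "finite \<Gamma>" and ne: "\<Gamma> \<noteq> {}"
    and l: "l \<in> forms 1" "\<And>p. p \<in> \<Gamma> \<Longrightarrow> line_eval p l \<noteq> 0"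
  shows "smooth_zero_dim (cone_ideal \<Gamma>)"
proof -
  interpret ac: field_embedding "to_ac :: 'k \<Rightarrow> 'k alg_closure" by (rule field_embedding_to_ac)
  let ?I = "cone_ideal \<Gamma>"
  note sub = cone_ideal_subspace[of \<Gamma>]
  have cancel: "\<Phi> \<in> ?I" if "l ^ m * \<Phi> \<in> ?I" for m \<Phi>
    using that l(2) by (auto simp: cone_ideal_def line_eval_mult line_eval_power)
  have proj: "proj_subscheme ?I"
  proof (rule proj_subschemeI[OF sub])
    show "hom_component d \<Phi> \<in> ?I" if "\<Phi> \<in> ?I" for \<Phi> d using that by (rule cone_ideal_homogeneous)
    show "\<Phi> \<in> ?I" if "\<And>\<Psi>. \<Psi> \<in> forms m \<Longrightarrow> \<Psi> * \<Phi> \<in> ?I" for \<Phi> m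
      using that[of "l ^ m"] forms_power[OF l(1), of m] cancel by simp
  qed
  have "hilbert_function ?I d \<le> hilbert_function ?I (Suc d)" for d
  proof -
    obtain b where b: "\<And>j. j < hilbert_function ?I d \<Longrightarrow> b j \<in> forms d"
      "indep_mod ?I b {..<hilbert_function ?I d}"
      using hilbert_function_basis[OF sub, of d thesis] by blast
    have "indep_mod ?I (\<lambda>j. l * b j) {..<hilbert_function ?I d}"
      unfolding indep_mod_def
    proof (intro allI impI)
      fix c assume "(\<Sum>j<hilbert_function ?I d. scale_poly (c j) (l * b j)) \<in> ?I"
      then have "l ^ 1 * (\<Sum>j<hilbert_function ?I d. scale_poly (c j) (b j)) \<in> ?I"
        by (simp add: sum_distrib_left mult_scale_poly_right)
      from cancel[OF this] b(2) show "\<forall>j\<in>{..<hilbert_function ?I d}. c j = 0"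
        unfolding indep_mod_def by blast
    qed
    moreover have "l * b j \<in> forms (Suc d)" if "j \<in> {..<hilbert_function ?I d}" for j
      using forms_mult[OF l(1) b(1)] that by simp
    ultimately show ?thesis
      using card_le_hilbert_function[OF sub, of "{..<hilbert_function ?I d}"] by simp
  qed
  then have "mono (hilbert_function ?I)" by (simp add: mono_iff_le_Suc)
  then obtain N where N: "\<And>d. N \<le> d \<Longrightarrow> hilbert_function ?I d = hilbert_function ?I N"
    using mono_bounded_nat_eventually_const hilbert_function_cone_ideal_le[OF fin] by metis
  have "indep_mod ?I (\<lambda>_. l ^ N) {()}"
    unfolding indep_mod_def
  proof (intro allI impI ballI)
    fix c :: "unit \<Rightarrow> 'k" and j assume "(\<Sum>j\<in>{()}. scale_poly (c j) (l ^ N)) \<in> ?I"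
    then have s: "scale_poly (c ()) (l ^ N) \<in> ?I" by simp
    have "l ^ N \<notin> ?I" using ne l(2) by (auto simp: cone_ideal_def line_eval_power)
    with s show "c j = 0" using ideal_scale_iff[OF sub, of "c ()"] by auto
  qed
  then have "hilbert_function ?I N > 0"
    using card_le_hilbert_function[OF sub, of "{()}" "\<lambda>_. l ^ N" N] forms_power[OF l(1), of N] by simp
  moreover have "eventually (\<lambda>d. hilbert_function ?I d = hilbert_function ?I N) sequentially"
    using N unfolding eventually_sequentially by blast
  ultimately have "zero_dim_subscheme ?I"
    unfolding zero_dim_subscheme_def using proj by blast
  moreover have "\<Phi> \<in> geometric_ideal ?I" if "\<Phi> ^ m \<in> geometric_ideal ?I" for \<Phi> m
    using that cone_ideal_radical
    unfolding geometric_ideal_base_change ac.base_change_cone_ideal by blast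
  ultimately show ?thesis unfolding smooth_zero_dim_def by blast
qed


section \<open>The apolarity pairing\<close>

text \<open>The bilinear form for which monomials are orthonormal; it is the constant term of the
  contraction.\<close>

definition pairing :: "('v, 'k::comm_ring_1) mpoly \<Rightarrow> ('v, 'k) mpoly \<Rightarrow> 'k" where
  "pairing F \<Phi> = (\<Sum>\<alpha>\<in>Poly_Mapping.keys F. Poly_Mapping.lookup F \<alpha> * Poly_Mapping.lookup \<Phi> \<alpha>)"

lemma pairing_add: "pairing F (\<Phi> + \<Psi>) = pairing F \<Phi> + pairing F \<Psi>"
  by (simp add: pairing_def lookup_add distrib_left sum.distrib)

lemma pairing_0 [simp]: "pairing F 0 = 0"
  by (simp add: pairing_def)

lemma pairing_sum: "pairing F (\<Sum>i\<in>A. f i) = (\<Sum>i\<in>A. pairing F (f i))"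
  by (induction A rule: infinite_finite_induct) (auto simp: pairing_add)

lemma pairing_scale: "pairing F (scale_poly c \<Phi>) = c * pairing F \<Phi>"
  by (simp add: pairing_def sum_distrib_left mult_ac)

lemma pairing_single: "pairing F (Poly_Mapping.single \<alpha> c) = Poly_Mapping.lookup F \<alpha> * c"
proof -
  have "pairing F (Poly_Mapping.single \<alpha> c) =
      (\<Sum>\<beta>\<in>Poly_Mapping.keys F. if \<beta> = \<alpha> then Poly_Mapping.lookup F \<alpha> * c else 0)"
    unfolding pairing_def by (rule sum.cong) (auto simp: lookup_single when_def)
  then show ?thesis by (simp add: in_keys_iff)
qed

text \<open>Contraction by \<Phi> is adjoint to multiplication by \<Phi>: for \<alpha> dividing
  \<beta>, the quotient is \<gamma> exactly when \<beta> = \<gamma> + \<alpha>.\<close>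

lemma lookup_contract:
  "Poly_Mapping.lookup (contract \<Phi> F) \<gamma> = pairing F (mon \<gamma> * \<Phi>)"
proof (induction \<Phi> rule: poly_mapping_single_add_induct)
  case (single \<alpha> c)
  have le_iff: "(\<forall>v. Poly_Mapping.lookup \<alpha> v \<le> Poly_Mapping.lookup \<beta> v) \<and> \<beta> - \<alpha> = \<gamma> \<longleftrightarrow> \<beta> = \<gamma> + \<alpha>" for \<beta>
  proof (intro iffI conjI allI)
    assume A: "(\<forall>v. Poly_Mapping.lookup \<alpha> v \<le> Poly_Mapping.lookup \<beta> v) \<and> \<beta> - \<alpha> = \<gamma>"
    show "\<beta> = \<gamma> + \<alpha>"
      by (rule poly_mapping_eqI) (use A in \<open>auto simp: lookup_add lookup_minus\<close>)
  qed (simp_all add: lookup_add)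
  have "Poly_Mapping.lookup (contract (Poly_Mapping.single \<alpha> c) F) \<gamma> =
      (\<Sum>\<beta>\<in>Poly_Mapping.keys F. if \<beta> = \<gamma> + \<alpha> then c * Poly_Mapping.lookup F (\<gamma> + \<alpha>) else 0)"
  proof (cases "c = 0")
    case False
    then have keys: "Poly_Mapping.keys (Poly_Mapping.single \<alpha> c) = {\<alpha>}" by simp
    have "Poly_Mapping.lookup (contract (Poly_Mapping.single \<alpha> c) F) \<gamma> =
        (\<Sum>\<beta>\<in>Poly_Mapping.keys F. Poly_Mapping.lookup
          (if \<forall>v. Poly_Mapping.lookup \<alpha> v \<le> Poly_Mapping.lookup \<beta> v
           then Poly_Mapping.single (\<beta> - \<alpha>) (c * Poly_Mapping.lookup F \<beta>) else 0) \<gamma>)"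
      unfolding contract_def keys by (simp add: lookup_sum cong: if_cong)
    also have "\<dots> = (\<Sum>\<beta>\<in>Poly_Mapping.keys F. if \<beta> = \<gamma> + \<alpha> then c * Poly_Mapping.lookup F (\<gamma> + \<alpha>) else 0)"
      by (rule sum.cong) (use le_iff in \<open>auto simp: lookup_single when_def\<close>)
    finally show ?thesis .
  qed (simp add: contract_def)
  then show ?case
    by (auto simp: mult_single pairing_single in_keys_iff add.commute[of \<alpha>] mult.commute[of c])
next
  case (add \<Phi> \<Psi>)
  have "contract (\<Phi> + \<Psi>) F = contract \<Phi> F + contract \<Psi> F"
    unfolding contract_def
    by (rule sum_keys_add)
      (auto simp: distrib_right single_add sum.distrib[symmetric] intro!: sum.cong sum.neutral)
  with add show ?case by (simp add: lookup_add distrib_left pairing_add)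
qed

text \<open>In this form truncated exponents no longer occur, and it is plain that the annihilator
  is an ideal.\<close>

lemma mem_Ann_iff: "\<Phi> \<in> Ann F \<longleftrightarrow> (\<forall>\<Psi>. pairing F (\<Psi> * \<Phi>) = 0)"
proof -
  have "\<Phi> \<in> Ann F \<longleftrightarrow> (\<forall>\<gamma>. pairing F (mon \<gamma> * \<Phi>) = 0)"
    unfolding Ann_def lookup_contract[symmetric] by (auto intro: poly_mapping_eqI)
  moreover have "pairing F (\<Psi> * \<Phi>) = 0" if "\<forall>\<gamma>. pairing F (mon \<gamma> * \<Phi>) = 0" for \<Psi>
  proof (induction \<Psi> rule: poly_mapping_single_add_induct)
    case (single \<alpha> c)
    have "Poly_Mapping.single \<alpha> c * \<Phi> = scale_poly c (mon \<alpha> * \<Phi>)"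
      by (simp add: mult_scale_poly_left[symmetric])
    with that show ?case by (simp add: pairing_scale)
  qed (simp add: distrib_right pairing_add)
  ultimately show ?thesis by blast
qed

lemma Ann_subspace: "self_module.subspace (Ann F)"
  unfolding self_module.subspace_def
  by (auto simp: mem_Ann_iff distrib_left pairing_add mult.assoc[symmetric])

context field_embedding
begin

lemma pairing_map: "pairing (Poly_Mapping.map h F) (Poly_Mapping.map h \<Phi>) = h (pairing F \<Phi>)"
proof -
  have "Poly_Mapping.keys (Poly_Mapping.map h F) = Poly_Mapping.keys F"
    by (auto simp: in_keys_iff lookup_map_zero)
  then show ?thesis by (simp add: pairing_def lookup_map_zero sum mult)
qed

text \<open>The annihilator is an ideal, so generators suffice. For them the multiplier is reduced
  to a monomial, and the pairing is the image of a pairing over the small field.\<close>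

lemma base_change_subset_Ann:
  assumes "I \<subseteq> Ann F"
  shows "base_change h I \<subseteq> Ann (Poly_Mapping.map h F)"
  unfolding base_change_def
proof (rule self_module.span_minimal[OF _ Ann_subspace], clarify)
  fix \<phi> assume "\<phi> \<in> I"
  then have \<phi>: "pairing F (\<Psi> * \<phi>) = 0" for \<Psi> using assms by (auto simp: mem_Ann_iff)
  have "pairing (Poly_Mapping.map h F) (\<Psi> * Poly_Mapping.map h \<phi>) = 0" for \<Psi>
  proof (induction \<Psi> rule: poly_mapping_single_add_induct)
    case (single \<alpha> c)
    have "Poly_Mapping.single \<alpha> c * Poly_Mapping.map h \<phi> =
        scale_poly c (Poly_Mapping.map h (mon \<alpha> * \<phi>))"
      by (simp add: map_mult mult_scale_poly_left[symmetric])
    then show ?case by (simp add: pairing_scale pairing_map \<phi>)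
  qed (simp add: distrib_right pairing_add)
  then show "Poly_Mapping.map h \<phi> \<in> Ann (Poly_Mapping.map h F)" by (simp add: mem_Ann_iff)
qed

end


section \<open>Forms supported on the graphs of permutations\<close>

text \<open>For a permutation \<sigma>, one term of the expansion of the minor with rows A and
  columns \<sigma>(A).\<close>

definition graph_monomial :: "'n set \<Rightarrow> ('n \<Rightarrow> 'n) \<Rightarrow> 'n::finite \<times> 'n \<Rightarrow>\<^sub>0 nat" where
  "graph_monomial A \<sigma> = (\<Sum>i\<in>A. Poly_Mapping.single (i, \<sigma> i) 1)"

lemma lookup_graph_monomial:
  "Poly_Mapping.lookup (graph_monomial A \<sigma>) (i, j) = (if i \<in> A \<and> j = \<sigma> i then 1 else 0)"
proof -
  have "Poly_Mapping.lookup (graph_monomial A \<sigma>) (i, j) =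
      (\<Sum>k\<in>A. if k = i then (if j = \<sigma> i then 1 else 0) else 0)"
    unfolding graph_monomial_def lookup_sum by (rule sum.cong) (auto simp: lookup_single when_def)
  then show ?thesis by simp
qed

lemma monom_degree_pairs:
  fixes \<alpha> :: "'n::finite \<times> 'm::finite \<Rightarrow>\<^sub>0 nat"
  shows "monom_degree \<alpha> = (\<Sum>i\<in>UNIV. \<Sum>j\<in>UNIV. Poly_Mapping.lookup \<alpha> (i, j))"
  unfolding monom_degree_UNIV UNIV_Times_UNIV[symmetric] sum.cartesian_product by simp

lemma monom_degree_graph_monomial [simp]: "monom_degree (graph_monomial A \<sigma>) = card A"
proof -
  have "monom_degree (graph_monomial A \<sigma>) = (\<Sum>i\<in>UNIV. \<Sum>j\<in>UNIV. if i \<in> A \<and> j = \<sigma> i then 1 else 0)"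
    by (simp add: monom_degree_pairs lookup_graph_monomial)
  also have "\<dots> = (\<Sum>i\<in>UNIV. if i \<in> A then 1 else 0)"
    by (rule sum.cong) auto
  also have "\<dots> = card A" by (simp add: sum.If_cases)
  finally show ?thesis .
qed

lemma graph_monomial_UNIV_eq_iff: "graph_monomial UNIV \<sigma> = graph_monomial UNIV \<tau> \<longleftrightarrow> \<sigma> = \<tau>"
proof
  assume eq: "graph_monomial UNIV \<sigma> = graph_monomial UNIV \<tau>"
  have "\<sigma> i = \<tau> i" for i
    using arg_cong[OF eq, of "\<lambda>\<alpha>. Poly_Mapping.lookup \<alpha> (i, \<sigma> i)"]
    by (simp add: lookup_graph_monomial split: if_splits)
  then show "\<sigma> = \<tau>" by blast
qed simp

text \<open>Both bounds use only this about determinant and permanent: the coefficients of the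
  permutation monomials are nonzero, and their values do not matter.\<close>

definition perm_supported :: "('n::finite \<times> 'n, 'k::zero) mpoly \<Rightarrow> bool" where
  "perm_supported F \<longleftrightarrow> Poly_Mapping.keys F = graph_monomial UNIV ` {\<sigma>. \<sigma> permutes UNIV}"

lemma perm_supported_sum:
  fixes \<epsilon> :: "('n::finite \<Rightarrow> 'n) \<Rightarrow> 'k::comm_ring_1"
  assumes "\<And>\<sigma>. \<epsilon> \<sigma> \<noteq> 0"
  shows "perm_supported (\<Sum>\<sigma> | \<sigma> permutes UNIV. Poly_Mapping.single (graph_monomial UNIV \<sigma>) (\<epsilon> \<sigma>))"
    (is "perm_supported ?F")
proof -
  have fin: "finite {\<sigma>. \<sigma> permutes (UNIV :: 'n set)}" by (rule finite_permutations) simp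
  have "Poly_Mapping.lookup ?F \<alpha> \<noteq> 0 \<longleftrightarrow> \<alpha> \<in> graph_monomial UNIV ` {\<sigma>. \<sigma> permutes UNIV}" for \<alpha>
  proof (cases "\<alpha> \<in> graph_monomial UNIV ` {\<sigma>. \<sigma> permutes UNIV}")
    case True
    then obtain \<tau> where \<tau>: "\<alpha> = graph_monomial UNIV \<tau>" "\<tau> permutes UNIV" by blast
    have "Poly_Mapping.lookup ?F \<alpha> = (\<Sum>\<sigma> | \<sigma> permutes UNIV. if \<sigma> = \<tau> then \<epsilon> \<tau> else 0)"
      unfolding lookup_sum \<tau>(1)
      by (rule sum.cong) (auto simp: lookup_single when_def graph_monomial_UNIV_eq_iff)
    also have "\<dots> = \<epsilon> \<tau>" using fin \<tau>(2) by simp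
    finally show ?thesis using True assms by simp
  next
    case False
    then have "Poly_Mapping.lookup ?F \<alpha> = 0"
      unfolding lookup_sum by (intro sum.neutral) (auto simp: lookup_single when_def)
    with False show ?thesis by simp
  qed
  then show ?thesis unfolding perm_supported_def by (auto simp: in_keys_iff)
qed

lemma prod_var_graph:
  "(\<Prod>i\<in>UNIV. (generic_matrix :: ('n::finite \<times> 'n, 'k::comm_ring_1) mpoly ^ 'n ^ 'n) $ i $ \<sigma> i) =
    mon (graph_monomial UNIV \<sigma>)"
proof -
  have "(\<Prod>i\<in>A. var (i, \<sigma> i) :: ('n \<times> 'n, 'k) mpoly) = mon (graph_monomial A \<sigma>)" if "finite A" for A
    using that by induction (auto simp: graph_monomial_def var_def mult_single)
  then show ?thesis by (simp add: generic_matrix_def)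
qed

lemma perm_supported_det:
  "perm_supported (det generic_matrix :: ('n::finite \<times> 'n, 'k::comm_ring_1) mpoly)"
proof -
  have "of_int (sign \<sigma>) * mon (graph_monomial UNIV \<sigma>) =
      (Poly_Mapping.single (graph_monomial UNIV \<sigma>) (of_int (sign \<sigma>)) :: ('n \<times> 'n, 'k) mpoly)"
    for \<sigma> :: "'n \<Rightarrow> 'n"
    by (cases \<sigma> rule: sign_cases) (auto simp: single_uminus)
  moreover have "(of_int (sign \<sigma>) :: 'k) \<noteq> 0" for \<sigma> :: "'n \<Rightarrow> 'n"
    by (cases \<sigma> rule: sign_cases) auto
  ultimately show ?thesis
    using perm_supported_sum[of "\<lambda>\<sigma> :: 'n \<Rightarrow> 'n. of_int (sign \<sigma>) :: 'k"]
    by (simp add: det_def prod_var_graph)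
qed

lemma perm_supported_permanent:
  "perm_supported (permanent generic_matrix :: ('n::finite \<times> 'n, 'k::comm_ring_1) mpoly)"
  using perm_supported_sum[of "\<lambda>\<sigma> :: 'n \<Rightarrow> 'n. 1 :: 'k"] by (simp add: permanent_def prod_var_graph)

lemma (in field_embedding) perm_supported_map:
  "perm_supported F \<Longrightarrow> perm_supported (Poly_Mapping.map h F)"
  by (simp add: perm_supported_def in_keys_iff lookup_map_zero set_eq_iff)


section \<open>The upper bound\<close>

text \<open>For signs s, a signed permutation matrix: the coefficient vector of the linear form with
  terms \<plusminus> a(i, \<sigma> i).\<close>

definition perm_point :: "('n \<Rightarrow> 'n) \<Rightarrow> ('n \<Rightarrow> 'k::zero) \<Rightarrow> 'n \<times> 'n \<Rightarrow> 'k" where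
  "perm_point \<sigma> s = (\<lambda>(i, j). if j = \<sigma> i then s i else 0)"

lemma mon_eval_perm_point:
  fixes s :: "'n::finite \<Rightarrow> 'k::field"
  shows "mon_eval (perm_point \<sigma> s) \<alpha> =
    (if \<forall>i j. j \<noteq> \<sigma> i \<longrightarrow> Poly_Mapping.lookup \<alpha> (i, j) = 0
     then \<Prod>i\<in>UNIV. s i ^ Poly_Mapping.lookup \<alpha> (i, \<sigma> i) else 0)"
proof -
  have eq: "mon_eval (perm_point \<sigma> s) \<alpha> =
      (\<Prod>i\<in>UNIV. \<Prod>j\<in>UNIV. (if j = \<sigma> i then s i else 0) ^ Poly_Mapping.lookup \<alpha> (i, j))"
    unfolding mon_eval_def UNIV_Times_UNIV[symmetric] prod.cartesian_product
    by (simp add: perm_point_def case_prod_beta)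
  show ?thesis
  proof (cases "\<forall>i j. j \<noteq> \<sigma> i \<longrightarrow> Poly_Mapping.lookup \<alpha> (i, j) = 0")
    case True
    have "(\<Prod>j\<in>UNIV. (if j = \<sigma> i then s i else 0) ^ Poly_Mapping.lookup \<alpha> (i, j)) =
        (\<Prod>j\<in>UNIV. if j = \<sigma> i then s i ^ Poly_Mapping.lookup \<alpha> (i, \<sigma> i) else 1)" for i
      by (rule prod.cong) (use True in auto)
    with True show ?thesis by (simp add: eq)
  next
    case False
    then obtain i j where ij: "j \<noteq> \<sigma> i" "Poly_Mapping.lookup \<alpha> (i, j) \<noteq> 0" by blast
    then have 0: "(\<Prod>j\<in>UNIV. (if j = \<sigma> i then s i else 0) ^ Poly_Mapping.lookup \<alpha> (i, j)) = 0"
      by (intro prod_zero) (auto intro!: bexI[of _ j])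
    have "mon_eval (perm_point \<sigma> s) \<alpha> = 0"
      unfolding eq by (intro prod_zero bexI[of _ i] 0) simp_all
    with ij show ?thesis by auto
  qed
qed

text \<open>
  The sum over the signs \<open>s\<close>, weighted by \<open>\<Prod>i. s i\<close>, isolates the monomials that are odd in
  each of the \<open>n\<close> variables \<open>(i, \<sigma> i)\<close>; in degree \<open>n\<close> there is only one.
\<close>

lemma sum_signs_mon_eval:
  fixes \<sigma> :: "'n::finite \<Rightarrow> 'n"
  assumes two: "(2 :: 'k::field) \<noteq> 0" and deg: "monom_degree \<alpha> = CARD('n)"
  shows "(\<Sum>s\<in>PiE UNIV (\<lambda>_. {- 1, 1 :: 'k}). (\<Prod>i\<in>UNIV. s i) * mon_eval (perm_point \<sigma> s) \<alpha>) =
    (if \<alpha> = graph_monomial UNIV \<sigma> then 2 ^ CARD('n) else 0)"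
proof (cases "\<forall>i j. j \<noteq> \<sigma> i \<longrightarrow> Poly_Mapping.lookup \<alpha> (i, j) = 0")
  case True
  let ?a = "\<lambda>i. Poly_Mapping.lookup \<alpha> (i, \<sigma> i)"
  have ne: "(- 1 :: 'k) \<noteq> 1"
    using two by (metis add.inverse_inverse add_eq_0_iff one_add_one)
  have "(\<Sum>s\<in>PiE UNIV (\<lambda>_. {- 1, 1 :: 'k}). (\<Prod>i\<in>UNIV. s i) * mon_eval (perm_point \<sigma> s) \<alpha>) =
      (\<Sum>s\<in>PiE UNIV (\<lambda>_. {- 1, 1 :: 'k}). \<Prod>i\<in>UNIV. s i ^ Suc (?a i))"
    using True by (simp add: mon_eval_perm_point prod.distrib)
  \<comment> \<open>The weight raises each exponent by one, so a factor is 2 for an odd exponent of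
    \<alpha> and 0 for an even one.\<close>
  also have "\<dots> = (\<Prod>i\<in>UNIV. \<Sum>y\<in>{- 1, 1 :: 'k}. y ^ Suc (?a i))"
    by (rule prod_sum_PiE[symmetric]) auto
  also have "\<dots> = (\<Prod>i\<in>UNIV. if odd (?a i) then 2 else 0)"
    using ne by (intro prod.cong) auto
  also have "\<dots> = (if \<alpha> = graph_monomial UNIV \<sigma> then 2 ^ CARD('n) else 0)"
  proof (cases "\<forall>i. odd (?a i)")
    case odd: True
    have "(\<Sum>i\<in>UNIV. \<Sum>j\<in>UNIV. Poly_Mapping.lookup \<alpha> (i, j)) = CARD('n)"
      using deg by (simp add: monom_degree_pairs)
    moreover have "(\<Sum>j\<in>UNIV. Poly_Mapping.lookup \<alpha> (i, j)) = ?a i" for i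
    proof -
      have "(\<Sum>j\<in>UNIV. Poly_Mapping.lookup \<alpha> (i, j)) = (\<Sum>j\<in>UNIV. if j = \<sigma> i then ?a i else 0)"
        by (rule sum.cong) (use True in auto)
      then show ?thesis by simp
    qed
    ultimately have s: "(\<Sum>i\<in>UNIV. ?a i) = (\<Sum>i\<in>(UNIV :: 'n set). 1)" by simp
    have ge: "1 \<le> ?a i" for i using odd by (simp add: Suc_leI odd_pos)
    have "?a i = 1" for i
    proof (rule ccontr)
      assume "?a i \<noteq> 1"
      with ge[of i] have "1 < ?a i" by simp
      then have "(\<Sum>i\<in>(UNIV :: 'n set). 1) < (\<Sum>i\<in>UNIV. ?a i)"
        using ge by (intro sum_strict_mono_ex1) auto
      with s show False by simp
    qed
    then have "\<alpha> = graph_monomial UNIV \<sigma>"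
      using True by (intro poly_mapping_eqI) (auto simp: lookup_graph_monomial)
    with odd show ?thesis by simp
  next
    case False
    then obtain i where i: "\<not> odd (?a i)" by blast
    then have "\<alpha> \<noteq> graph_monomial UNIV \<sigma>" by (auto simp: lookup_graph_monomial)
    moreover have "(\<Prod>i\<in>UNIV. if odd (?a i) then 2 else 0 :: 'k) = 0"
      using i by (intro prod_zero) (auto intro!: bexI[of _ i])
    ultimately show ?thesis by simp
  qed
  finally show ?thesis .
next
  case False
  then have "\<alpha> \<noteq> graph_monomial UNIV \<sigma>" by (auto simp: lookup_graph_monomial)
  moreover have "mon_eval (perm_point \<sigma> s) \<alpha> = 0" for s :: "'n \<Rightarrow> 'k"
    unfolding mon_eval_perm_point using False by (rule if_not_P)
  ultimately show ?thesis by simp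
qed

text \<open>The points are all signed permutation matrices, rational over the ground field. If
  \<Theta> vanishes at those of \<sigma>, the weighted sum of the values of its degree n component
  is 2^n times its coefficient at the monomial of \<sigma>, which is therefore zero. Applied to all
  multiples of a member of the ideal, this gives apolarity.\<close>

lemma exists_smooth_apolar_scheme:
  fixes F :: "('n::finite \<times> 'n, 'k::field) mpoly"
  assumes two: "(2 :: 'k) \<noteq> 0" and F: "perm_supported F"
  obtains I where "smooth_zero_dim I" "I \<subseteq> Ann F"
proof -
  let ?S = "PiE UNIV (\<lambda>_. {- 1, 1 :: 'k}) :: ('n \<Rightarrow> 'k) set"
  define \<Gamma> where "\<Gamma> = (\<lambda>(\<sigma>, s). perm_point \<sigma> s) ` ({\<sigma>. \<sigma> permutes (UNIV :: 'n set)} \<times> ?S)"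
  have finS: "finite ?S" by (intro finite_PiE) auto
  have fin: "finite \<Gamma>"
    unfolding \<Gamma>_def by (intro finite_imageI finite_cartesian_product finite_permutations finS) simp
  have "perm_point id (\<lambda>_. 1) \<in> \<Gamma>"
    unfolding \<Gamma>_def by (rule image_eqI[of _ _ "(id, \<lambda>_. 1)"]) (auto simp: permutes_id)
  then have ne: "\<Gamma> \<noteq> {}" by blast
  fix i0 :: 'n
  \<comment> \<open>The sum of one row of a signed permutation matrix is 1 or -1, so this form
    misses every point over any field.\<close>
  define l where "l = (\<Sum>j\<in>UNIV. var (i0, j) :: ('n \<times> 'n, 'k) mpoly)"
  have l1: "l \<in> forms 1" unfolding l_def by (intro forms_sum var_mem_forms)
  have l2: "line_eval p l \<noteq> 0" if p: "p \<in> \<Gamma>" for p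
  proof -
    obtain \<sigma> s where p: "p = perm_point \<sigma> s" "s \<in> ?S" using p unfolding \<Gamma>_def by auto
    have "line_eval p l = monom (\<Sum>j\<in>UNIV. p (i0, j)) 1"
      unfolding l_def line_eval_sum by (rule poly_eqI) (simp add: coeff_sum)
    also have "(\<Sum>j\<in>UNIV. p (i0, j)) = s i0" by (simp add: p perm_point_def)
    finally show ?thesis using PiE_mem[OF p(2), of i0] by auto
  qed
  have zero: "Poly_Mapping.lookup \<Theta> (graph_monomial UNIV \<sigma>) = 0"
    if \<Theta>: "\<Theta> \<in> cone_ideal \<Gamma>" and \<sigma>: "\<sigma> permutes UNIV" for \<Theta> \<sigma>
  proof -
    let ?K = "{\<alpha> \<in> Poly_Mapping.keys \<Theta>. monom_degree \<alpha> = CARD('n)}"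
    have "coeff (line_eval (perm_point \<sigma> s) \<Theta>) CARD('n) = 0" if "s \<in> ?S" for s
      using \<Theta> \<sigma> that by (auto simp: cone_ideal_def \<Gamma>_def)
    then have "0 = (\<Sum>s\<in>?S. (\<Prod>i\<in>UNIV. s i) * coeff (line_eval (perm_point \<sigma> s) \<Theta>) CARD('n))"
      by simp
    also have "\<dots> = (\<Sum>s\<in>?S. \<Sum>\<alpha>\<in>?K. Poly_Mapping.lookup \<Theta> \<alpha> *
        ((\<Prod>i\<in>UNIV. s i) * mon_eval (perm_point \<sigma> s) \<alpha>))"
      by (simp add: coeff_line_eval sum_distrib_left mult_ac)
    also have "\<dots> = (\<Sum>\<alpha>\<in>?K. Poly_Mapping.lookup \<Theta> \<alpha> *
        (\<Sum>s\<in>?S. (\<Prod>i\<in>UNIV. s i) * mon_eval (perm_point \<sigma> s) \<alpha>))"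
      by (subst sum.swap) (simp add: sum_distrib_left)
    also have "\<dots> = (\<Sum>\<alpha>\<in>?K. if \<alpha> = graph_monomial UNIV \<sigma>
        then Poly_Mapping.lookup \<Theta> (graph_monomial UNIV \<sigma>) * 2 ^ CARD('n) else 0)"
      by (rule sum.cong) (auto simp: sum_signs_mon_eval[OF two])
    also have "\<dots> = Poly_Mapping.lookup \<Theta> (graph_monomial UNIV \<sigma>) * 2 ^ CARD('n)"
      by (simp add: in_keys_iff)
    finally show ?thesis using two by simp
  qed
  have "cone_ideal \<Gamma> \<subseteq> Ann F"
  proof
    fix \<Phi> assume "\<Phi> \<in> cone_ideal \<Gamma>"
    then have "\<Psi> * \<Phi> \<in> cone_ideal \<Gamma>" for \<Psi>
      by (rule self_module.subspace_scale[OF cone_ideal_subspace])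
    then have "pairing F (\<Psi> * \<Phi>) = 0" for \<Psi>
      using F zero unfolding pairing_def perm_supported_def by (intro sum.neutral) auto
    then show "\<Phi> \<in> Ann F" by (simp add: mem_Ann_iff)
  qed
  with smooth_zero_dim_cone_ideal[OF fin ne l1 l2] that show ?thesis by blast
qed


section \<open>The lower bound\<close>

lemma exists_permutes_image:
  fixes A B :: "'n::finite set"
  assumes "card A = card B"
  shows "\<exists>\<sigma>. \<sigma> permutes UNIV \<and> \<sigma> ` A = B"
proof -
  obtain f where f: "bij_betw f A B"
    using finite_same_card_bij[of A B] assms by auto
  have "card (- A) = card (- B)" using assms by (simp add: Compl_eq_Diff_UNIV card_Diff_subset)
  then obtain g where g: "bij_betw g (- A) (- B)"
    using finite_same_card_bij[of "- A" "- B"] by auto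
  let ?\<sigma> = "\<lambda>x. if x \<in> A then f x else g x"
  have "bij_betw ?\<sigma> (A \<union> - A) (B \<union> - B)"
    by (rule bij_betw_disjoint_Un[OF f g]) auto
  then have "?\<sigma> permutes UNIV" by (simp add: permutes_def bij_iff)
  moreover have "?\<sigma> ` A = B" using f by (auto simp: bij_betw_def)
  ultimately show ?thesis by blast
qed

text \<open>A permutation monomial meets every row once, so the rows of the two factors are
  complementary and C = A. Then \<rho> agrees with \<sigma> off A, and bijectivity leaves exactly B
  as the image of A.\<close>

lemma graph_monomial_Compl_add_eq:
  assumes \<sigma>: "\<sigma> permutes UNIV" "\<sigma> ` A = B" and \<tau>: "\<tau> permutes UNIV" "\<tau> ` C = D"
    and \<rho>: "\<rho> permutes UNIV" and eq: "graph_monomial (- A) \<sigma> + graph_monomial C \<tau> = graph_monomial UNIV \<rho>"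
  shows "C = A \<and> D = B"
proof -
  have l: "(if i \<notin> A \<and> j = \<sigma> i then 1 else 0 :: nat) + (if i \<in> C \<and> j = \<tau> i then 1 else 0) =
      (if j = \<rho> i then 1 else 0)" for i j
    using arg_cong[OF eq, of "\<lambda>\<alpha>. Poly_Mapping.lookup \<alpha> (i, j)"]
    by (simp add: lookup_add lookup_graph_monomial)
  have "i \<in> A \<longleftrightarrow> i \<in> C" for i
  proof (cases "i \<in> A")
    case True
    with l[of i "\<rho> i"] show ?thesis by (auto split: if_splits)
  next
    case False
    with l[of i "\<sigma> i"] l[of i "\<tau> i"] show ?thesis by (auto split: if_splits)
  qed
  then have CA: "C = A" by blast
  have \<rho>\<sigma>: "\<rho> i = \<sigma> i" if "i \<notin> A" for i
    using l[of i "\<sigma> i"] that by (auto split: if_splits)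
  have \<rho>\<tau>: "\<rho> i = \<tau> i" if "i \<in> A" for i
    using l[of i "\<tau> i"] that CA by (auto split: if_splits)
  have "D = \<rho> ` A" using \<tau>(2) \<rho>\<tau> CA by auto
  also have "\<rho> ` A = - (\<rho> ` (- A))"
    using bij_image_Compl_eq[OF permutes_bij[OF \<rho>], of "- A"] by simp
  also have "\<rho> ` (- A) = \<sigma> ` (- A)" using \<rho>\<sigma> by auto
  also have "\<sigma> ` (- A) = - B"
    using bij_image_Compl_eq[OF permutes_bij[OF \<sigma>(1)], of A] \<sigma>(2) by simp
  finally show ?thesis using CA by simp
qed

text \<open>All monomials of \<open>F\<close> are squarefree.\<close>

lemma var_square_mem_Ann:
  fixes F :: "('n::finite \<times> 'n, 'k::field) mpoly"
  assumes F: "perm_supported F"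
  shows "var v ^ 2 \<in> Ann F"
proof -
  have "pairing F (\<Psi> * var v ^ 2) = 0" for \<Psi>
  proof (induction \<Psi> rule: poly_mapping_single_add_induct)
    case (single \<alpha> c)
    have "\<alpha> + Poly_Mapping.single v 2 \<notin> Poly_Mapping.keys F"
    proof
      assume "\<alpha> + Poly_Mapping.single v 2 \<in> Poly_Mapping.keys F"
      then obtain \<sigma> where eq: "\<alpha> + Poly_Mapping.single v 2 = graph_monomial UNIV \<sigma>"
        using F by (auto simp: perm_supported_def)
      show False
        using arg_cong[OF eq, of "\<lambda>\<alpha>. Poly_Mapping.lookup \<alpha> v"]
        by (cases v) (auto simp: lookup_add lookup_graph_monomial split: if_splits)
    qed
    then show ?case by (simp add: var_power mult_single pairing_single in_keys_iff)
  qed (simp add: distrib_right pairing_add)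
  then show ?thesis by (simp add: mem_Ann_iff)
qed

text \<open>
  For every pair of sets of \<open>d\<close> rows and \<open>d\<close> columns there is a monomial of degree \<open>d\<close>. The pairing
  with \<open>F\<close> separates these monomials from each other and from \<open>I\<close> and the multiples of \<open>g\<close>, all
  of which lie in \<open>Ann F\<close>.
\<close>

lemma card_add_binomial_square_le_hilbert_function:
  fixes F :: "('n::finite \<times> 'n, 'k::field) mpoly" and b :: "nat \<Rightarrow> ('n \<times> 'n, 'k) mpoly"
  assumes F: "perm_supported F" and I: "self_module.subspace I" "I \<subseteq> Ann F"
    and g: "g \<in> Ann F" "\<And>\<phi>. \<phi> \<in> forms e \<Longrightarrow> g * \<phi> \<in> I \<Longrightarrow> \<phi> \<in> I"
    and J: "finite J" "indep_mod I b J"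
    and b: "\<And>j. j \<in> J \<Longrightarrow> b j \<in> forms e" "\<And>j. j \<in> J \<Longrightarrow> g * b j \<in> forms d"
  shows "card J + (CARD('n) choose d)\<^sup>2 \<le> hilbert_function I d"
proof -
  define P where "P = {A :: 'n set. card A = d} \<times> {B :: 'n set. card B = d}"
  have cardP: "card P = (CARD('n) choose d)\<^sup>2"
    using n_subsets[of "UNIV :: 'n set" d] by (simp add: P_def card_cartesian_product power2_eq_square)
  have "\<exists>\<sigma>. \<sigma> permutes UNIV \<and> \<sigma> ` fst c = snd c" if "c \<in> P" for c
    using that by (intro exists_permutes_image) (auto simp: P_def)
  then obtain \<tau> where \<tau>: "\<And>c. c \<in> P \<Longrightarrow> \<tau> c permutes UNIV" "\<And>c. c \<in> P \<Longrightarrow> \<tau> c ` fst c = snd c"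
    by metis
  define m :: "'n set \<times> 'n set \<Rightarrow> ('n \<times> 'n, 'k) mpoly"
    where "m c = mon (graph_monomial (fst c) (\<tau> c))" for c
  have mf: "m c \<in> forms d" if "c \<in> P" for c
    using that by (auto simp: m_def P_def)
  have indep: "u c = 0" if \<Theta>: "(\<Sum>c\<in>P. scale_poly (u c) (m c)) \<in> Ann F" and c: "c \<in> P" for u c
  proof -
    \<comment> \<open>The term of the complementary minor: it completes the monomial of c to a
      permutation monomial, and that of no other pair.\<close>
    let ?\<nu> = "mon (graph_monomial (- fst c) (\<tau> c)) :: ('n \<times> 'n, 'k) mpoly"
    have pair: "pairing F (?\<nu> * m c') =
        (if c' = c then Poly_Mapping.lookup F (graph_monomial UNIV (\<tau> c)) else 0)" if c': "c' \<in> P" for c'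
    proof (cases "c' = c")
      case True
      have "graph_monomial (- fst c) (\<tau> c) + graph_monomial (fst c) (\<tau> c) = graph_monomial UNIV (\<tau> c)"
        by (rule poly_mapping_eqI) (auto simp: lookup_add lookup_graph_monomial)
      with True show ?thesis by (simp add: m_def mult_single pairing_single)
    next
      case False
      have "graph_monomial (- fst c) (\<tau> c) + graph_monomial (fst c') (\<tau> c') \<notin> Poly_Mapping.keys F"
      proof
        assume "graph_monomial (- fst c) (\<tau> c) + graph_monomial (fst c') (\<tau> c') \<in> Poly_Mapping.keys F"
        then obtain \<rho> where \<rho>: "\<rho> permutes UNIV"
          "graph_monomial (- fst c) (\<tau> c) + graph_monomial (fst c') (\<tau> c') = graph_monomial UNIV \<rho>"
          using F by (auto simp: perm_supported_def)
        from graph_monomial_Compl_add_eq[OF \<tau>(1,2)[OF c] \<tau>(1,2)[OF c'] this] False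
        show False by (simp add: prod_eq_iff)
      qed
      with False show ?thesis by (simp add: m_def mult_single pairing_single in_keys_iff)
    qed
    have "0 = pairing F (?\<nu> * (\<Sum>c\<in>P. scale_poly (u c) (m c)))"
      using \<Theta> by (simp add: mem_Ann_iff)
    also have "\<dots> = (\<Sum>c'\<in>P. u c' * pairing F (?\<nu> * m c'))"
      by (simp add: sum_distrib_left mult_scale_poly_right pairing_sum pairing_scale)
    also have "\<dots> = (\<Sum>c'\<in>P. if c' = c then u c * Poly_Mapping.lookup F (graph_monomial UNIV (\<tau> c)) else 0)"
      by (rule sum.cong) (auto simp: pair)
    also have "\<dots> = u c * Poly_Mapping.lookup F (graph_monomial UNIV (\<tau> c))" using c by simp
    finally have "u c * Poly_Mapping.lookup F (graph_monomial UNIV (\<tau> c)) = 0" by simp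
    moreover have "graph_monomial UNIV (\<tau> c) \<in> Poly_Mapping.keys F"
      using F \<tau>(1)[OF c] by (auto simp: perm_supported_def)
    ultimately show ?thesis by (simp add: in_keys_iff)
  qed
  let ?J = "J <+> P" and ?f = "case_sum (\<lambda>j. g * b j) m"
  have "indep_mod I ?f ?J"
    unfolding indep_mod_def
  proof (intro allI impI)
    fix u :: "nat + 'n set \<times> 'n set \<Rightarrow> 'k"
    assume s: "(\<Sum>x\<in>?J. scale_poly (u x) (?f x)) \<in> I"
    let ?\<Theta> = "\<Sum>c\<in>P. scale_poly (u (Inr c)) (m c)" and ?\<Phi> = "\<Sum>j\<in>J. scale_poly (u (Inl j)) (b j)"
    have eq: "(\<Sum>x\<in>?J. scale_poly (u x) (?f x)) = g * ?\<Phi> + ?\<Theta>"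
      using J(1) by (simp add: sum.Plus sum_distrib_left mult_scale_poly_right)
    \<comment> \<open>All multiples of \<open>g\<close> lie in \<open>Ann F\<close>, so the
      coefficients of the minors vanish first; only then does the nonzerodivisor property apply to
      what remains.\<close>
    have "g * ?\<Phi> + ?\<Theta> \<in> Ann F" using s I(2) unfolding eq by blast
    moreover have "g * ?\<Phi> \<in> Ann F"
      by (subst mult.commute) (rule self_module.subspace_scale[OF Ann_subspace g(1)])
    ultimately have "g * ?\<Phi> + ?\<Theta> - g * ?\<Phi> \<in> Ann F"
      by (rule self_module.subspace_diff[OF Ann_subspace])
    then have "?\<Theta> \<in> Ann F" by simp
    then have uP: "u (Inr c) = 0" if "c \<in> P" for c by (rule indep[OF _ that])
    then have "g * ?\<Phi> \<in> I" using s unfolding eq by simp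
    moreover have "?\<Phi> \<in> forms e" by (intro forms_sum forms_scale b(1))
    ultimately have "?\<Phi> \<in> I" by (rule g(2)[rotated])
    then have "u (Inl j) = 0" if "j \<in> J" for j by (rule indep_modD[OF J(2) _ that])
    with uP show "\<forall>x\<in>?J. u x = 0" by auto
  qed
  moreover have "?f x \<in> forms d" if "x \<in> ?J" for x using that b(2) mf by auto
  ultimately have "card ?J \<le> hilbert_function I d"
    using J(1) by (intro card_le_hilbert_function[OF I(1)]) (auto simp: finite_Plus)
  then show ?thesis using J(1) cardP by (simp add: card_Plus)
qed

text \<open>Far out, two consecutive values of the Hilbert function add up to twice the degree, and
  together they dominate the sum of the squares of all binomial coefficients (n choose d).\<close>

lemma binomial_le_scheme_degree_alg_closed:
  fixes F :: "('n::finite \<times> 'n, 'k::alg_closed_field) mpoly"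
  assumes F: "perm_supported F" and I: "zero_dim_subscheme I" "I \<subseteq> Ann F"
  shows "(2 * CARD('n)) choose CARD('n) \<le> 2 * scheme_degree I"
proof -
  have sub: "self_module.subspace I"
    using I by (simp add: zero_dim_subscheme_def proj_subscheme_subspace)
  obtain c where c: "\<forall>e. \<forall>\<phi>\<in>forms e. (\<Sum>v\<in>UNIV. scale_poly (c v) (var v ^ 2)) * \<phi> \<in> I \<longrightarrow> \<phi> \<in> I"
    using exists_diagonal_quadric_nonzerodivisor[OF I(1)] by blast
  define g where "g = (\<Sum>v\<in>UNIV. scale_poly (c v) (var v ^ 2) :: ('n \<times> 'n, 'k) mpoly)"
  have gA: "g \<in> Ann F"
    unfolding g_def by (intro self_module.subspace_sum[OF Ann_subspace] ideal_scale[OF Ann_subspace]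
        var_square_mem_Ann[OF F])
  have g2: "g \<in> forms 2"
    unfolding g_def using forms_power[OF var_mem_forms, of _ 2]
    by (intro forms_sum forms_scale) simp
  have gI: "\<phi> \<in> I" if "\<phi> \<in> forms e" "g * \<phi> \<in> I" for \<phi> e
    using c that by (simp add: g_def)
  have bound: "card J + (CARD('n) choose d)\<^sup>2 \<le> hilbert_function I d"
    if "finite J" "indep_mod I b J" "\<And>j. j \<in> J \<Longrightarrow> b j \<in> forms e" "\<And>j. j \<in> J \<Longrightarrow> g * b j \<in> forms d"
    for J :: "nat set" and b d e
    by (rule card_add_binomial_square_le_hilbert_function[OF F sub I(2) gA gI[where e = e] that])
  \<comment> \<open>With an empty family the bound counts the minors alone; this starts the
    recursion in degrees 0 and 1.\<close>
  have H0: "(CARD('n) choose d)\<^sup>2 \<le> hilbert_function I d" for d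
    using bound[of "{}" "\<lambda>_. 0" 0 d] by (simp add: indep_mod_def)
  have H2: "hilbert_function I d + (CARD('n) choose (d + 2))\<^sup>2 \<le> hilbert_function I (d + 2)" for d
  proof -
    obtain b where b: "\<And>j. j < hilbert_function I d \<Longrightarrow> b j \<in> forms d"
      "indep_mod I b {..<hilbert_function I d}"
      using hilbert_function_basis[OF sub, of d thesis] by blast
    have "g * b j \<in> forms (d + 2)" if "j < hilbert_function I d" for j
      using forms_mult[OF g2 b(1)[OF that]] by (simp add: add.commute)
    with bound[of "{..<hilbert_function I d}" b d "d + 2"] b show ?thesis by simp
  qed
  \<comment> \<open>The recursion advances by 2, so even and odd degrees accumulate separately and
    two consecutive values are needed to collect all squares.\<close>
  have sum: "(\<Sum>d\<le>Suc D. (CARD('n) choose d)\<^sup>2) \<le> hilbert_function I (Suc D) + hilbert_function I D" for D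
  proof (induction D)
    case 0
    show ?case using H0[of 0] H0[of 1] by simp
  next
    case (Suc D)
    then show ?case using H2[of D] by simp
  qed
  have "eventually (\<lambda>D. hilbert_function I D = scheme_degree I \<and> CARD('n) \<le> D) sequentially"
    using eventually_scheme_degree[OF I(1)] eventually_ge_at_top by (rule eventually_conj)
  then obtain D where D: "\<And>d. D \<le> d \<Longrightarrow> hilbert_function I d = scheme_degree I \<and> CARD('n) \<le> d"
    unfolding eventually_sequentially by blast
  have "(2 * CARD('n)) choose CARD('n) = (\<Sum>d\<le>CARD('n). (CARD('n) choose d)\<^sup>2)"
    by (rule choose_square_sum[symmetric])
  also have "\<dots> \<le> (\<Sum>d\<le>Suc D. (CARD('n) choose d)\<^sup>2)"
    using D[of D] by (intro sum_mono2) auto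
  also have "\<dots> \<le> 2 * scheme_degree I" using sum[of D] D[of D] D[of "Suc D"] by simp
  finally show ?thesis .
qed

text \<open>Degree, apolarity and the support of \<open>F\<close> all survive the passage to the
  algebraic closure.\<close>

lemma binomial_le_scheme_degree:
  fixes F :: "('n::finite \<times> 'n, 'k::field) mpoly"
  assumes F: "perm_supported F" and I: "zero_dim_subscheme I" "I \<subseteq> Ann F"
  shows "(2 * CARD('n)) choose CARD('n) \<le> 2 * scheme_degree I"
proof -
  interpret ac: field_embedding "to_ac :: 'k \<Rightarrow> 'k alg_closure" by (rule field_embedding_to_ac)
  have sub: "self_module.subspace I"
    using I by (simp add: zero_dim_subscheme_def proj_subscheme_subspace)
  have "(2 * CARD('n)) choose CARD('n) \<le> 2 * scheme_degree (base_change to_ac I)"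
    by (intro binomial_le_scheme_degree_alg_closed[of "Poly_Mapping.map to_ac F"]
        ac.perm_supported_map F ac.zero_dim_subscheme_base_change ac.base_change_subset_Ann I)
  then show ?thesis by (simp add: ac.scheme_degree_base_change[OF sub])
qed

theorem theorem3p5:
  fixes F :: "('n::finite \<times> 'n, 'k::field) mpoly"
  assumes "CHAR('k) = 0 \<or> CHAR('k) > 2"
    and "F = det generic_matrix \<or> F = permanent generic_matrix"
  shows "1 / 2 * real ((2 * CARD('n)) choose CARD('n)) \<le> real (cactus_rank F)
    \<and> cactus_rank F \<le> smoothable_rank F
    \<and> smoothable_rank F \<le> form_rank F"
proof -
  have F: "perm_supported F"
    using assms(2) perm_supported_det perm_supported_permanent by blast
  have "\<not> CHAR('k) dvd 2"
    using assms(1) by (auto dest: dvd_imp_le)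
  then have two: "(2 :: 'k) \<noteq> 0"
    using of_nat_eq_0_iff_char_dvd[of 2, where 'a = 'k] by simp
  define C where "C = {scheme_degree I | I. zero_dim_subscheme I \<and> I \<subseteq> Ann F}"
  define S where "S = {scheme_degree I | I. smoothable I \<and> I \<subseteq> Ann F}"
  define R where "R = {scheme_degree I | I. smooth_zero_dim I \<and> I \<subseteq> Ann F}"
  \<comment> \<open>An empty set would have infimum 0 and break the chain; a smooth apolar scheme
    makes all three sets nonempty.\<close>
  have R: "R \<noteq> {}"
    using exists_smooth_apolar_scheme[OF two F] unfolding R_def by blast
  have RS: "R \<subseteq> S" unfolding R_def S_def using smooth_zero_dim_imp_smoothable by blast
  have SC: "S \<subseteq> C" unfolding S_def C_def smoothable_def by blast
  have "Inf C \<in> C" using R RS SC by (intro Inf_nat_def1) blast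
  then have "(2 * CARD('n)) choose CARD('n) \<le> 2 * Inf C"
    unfolding C_def using binomial_le_scheme_degree[OF F] by fastforce
  moreover have "Inf C \<le> Inf S" using R RS SC by (intro cInf_superset_mono) auto
  moreover have "Inf S \<le> Inf R" using R RS by (intro cInf_superset_mono) auto
  ultimately show ?thesis
    unfolding cactus_rank_def smoothable_rank_def form_rank_def C_def S_def R_def by linarith
qed

end
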